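(* For billiards on the tori $\mathbb{T}^m=\mathbb{R}^m/\mathbb{Z}^m$, $m\ge 2$, with one small obstacle $O$, the radius of the largest ball centered at $\mathbf{0}$ contained in the admissible rotation set $AR$ goes to $1$ uniformly in $m$ as the diameter of the obstacle goes to $0$. That is, for every $\varepsilon>0$ there is $\delta>0$ such that for every $m\ge 2$ and every small obstacle $O$ on $\mathbb{T}^m$ of diameter less than $\delta$, the radius $\rho$ of the largest closed ball centered at $\mathbf{0}$ contained in $AR$ satisfies $|\rho-1|<\varepsilon$.
   Context: Setting: the obstacle $O$ on $\mathbb{T}^m$ lifts to a family of pairwise disjoint sets $O_{\mathbf{k}}=O_{\mathbf{0}}+\mathbf{k}$, $\mathbf{k}\in\mathbb{Z}^m$, in $\mathbb{R}^m$, where $O_{\mathbf{0}}$ is compact, has nonempty interior and smooth boundary, and is strictly convex (convex, with boundary containing no straight line segment). $O$ is small if it is contained in a closed ball of radius smaller than $\sqrt{2}/4$ (the lifting is then chosen so that $O_{\mathbf{k}}$ is contained in such a ball centered at $\mathbf{k}$). Billiard trajectories move with unit speed along straight lines outside the interiors of the obstacles and reflect from obstacle boundaries with angle of incidence equal to angle of reflection; trajectories are lifted to $\mathbb{R}^m$, and the time along a trajectory piece equals its length. A tangency is not counted as a reflection. Admissibility: $O_{\mathbf{k}}$ is between $O_{\mathbf{i}}$ and $O_{\mathbf{j}}$ if $\mathbf{k}\ne\mathbf{i},\mathbf{j}$ and $O_{\mathbf{k}}$ intersects the convex hull of $O_{\mathbf{i}}\cup O_{\mathbf{j}}$. A (finite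 or infinite) sequence $(\mathbf{k}_n)_{n\ge 0}$ in $\mathbb{Z}^m$ is admissible if (1) $\mathbf{k}_0=\mathbf{0}$; (2) $\mathbf{k}_{n+1}\ne\mathbf{k}_n$ for every $n$; (3) for every $n$ there is no obstacle between $O_{\mathbf{k}_n}$ and $O_{\mathbf{k}_{n+1}}$; (4) for every $n$ the obstacle $O_{\mathbf{k}_{n+1}}$ is not between $O_{\mathbf{k}_n}$ and $O_{\mathbf{k}_{n+2}}$. A trajectory piece in $\mathbb{R}^m$ has type $(\mathbf{k}_n)_{n=0}^s$ if it starts on the boundary of $O_{\mathbf{k}_0}$, reflects consecutively from $O_{\mathbf{k}_1},\dots,O_{\mathbf{k}_{s-1}}$ and ends on the boundary of $O_{\mathbf{k}_s}$ (translating so that $\mathbf{k}_0=\mathbf{0}$). The admissible rotation set $AR$ is the set of all limits of sequences $((\mathbf{y}_n-\mathbf{x}_n)/t_n)_{n=1}^\infty$ such that there is a trajectory piece of admissible type in $\mathbb{R}^m$ from $\mathbf{x}_n$ to $\mathbf{y}_n$ of length $t_n$, and $t_n\to\infty$. *)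

theory Defs
  imports "HOL-Analysis.Analysis"
begin

text \<open>
  The bound in the theorem is chosen before the dimension, so all the spaces $R^m$ have to live in
  one type.  We take the finitely supported real sequences with the Euclidean inner product and
  let $R^m$ be the subspace of sequences supported in $\{0,\dots,m-1\}$.  Norm, convexity, compactness
  and limits are then the library notions; openness, interiors, boundaries and derivatives are taken
  relative to the subspace, since the subspace has empty interior in the whole type.
\<close>

typedef fseq = "{x :: nat \<Rightarrow> real. finite {i. x i \<noteq> 0}}"
  morphisms coord Abs_fseq
  by (rule exI[of _ "\<lambda>_. 0"]) simp

lemma finite_supp [simp]: "finite {i. coord x i \<noteq> 0}"
  using coord[of x] by simp

lemma fseq_eqI: "(\<And>i. coord x i = coord y i) \<Longrightarrow> x = y"
  by (metis coord_inject ext)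

lemma coord_Abs: "finite {i. f i \<noteq> 0} \<Longrightarrow> coord (Abs_fseq f) = f"
  by (simp add: Abs_fseq_inverse)

instantiation fseq :: real_vector
begin

definition zero_fseq :: fseq where
  "0 = Abs_fseq (\<lambda>i. 0)"

definition plus_fseq :: "fseq \<Rightarrow> fseq \<Rightarrow> fseq" where
  "x + y = Abs_fseq (\<lambda>i. coord x i + coord y i)"

definition uminus_fseq :: "fseq \<Rightarrow> fseq" where
  "- x = Abs_fseq (\<lambda>i. - coord x i)"

definition minus_fseq :: "fseq \<Rightarrow> fseq \<Rightarrow> fseq" where
  "x - y = Abs_fseq (\<lambda>i. coord x i - coord y i)"

definition scaleR_fseq :: "real \<Rightarrow> fseq \<Rightarrow> fseq" where
  "c *\<^sub>R x = Abs_fseq (\<lambda>i. c * coord x i)"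

lemma coord_zero [simp]: "coord 0 i = 0"
  by (simp add: zero_fseq_def coord_Abs)

lemma coord_plus [simp]: "coord (x + y) i = coord x i + coord y i"
proof -
  have "{i. coord x i + coord y i \<noteq> 0} \<subseteq> {i. coord x i \<noteq> 0} \<union> {i. coord y i \<noteq> 0}"
    by auto
  then have "finite {i. coord x i + coord y i \<noteq> 0}"
    using finite_supp finite_UnI finite_subset by metis
  then show ?thesis
    by (simp add: plus_fseq_def coord_Abs)
qed

lemma coord_uminus [simp]: "coord (- x) i = - coord x i"
  by (simp add: uminus_fseq_def coord_Abs)

lemma coord_minus [simp]: "coord (x - y) i = coord x i - coord y i"
proof -
  have "{i. coord x i - coord y i \<noteq> 0} \<subseteq> {i. coord x i \<noteq> 0} \<union> {i. coord y i \<noteq> 0}"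
    by auto
  then have "finite {i. coord x i - coord y i \<noteq> 0}"
    using finite_supp finite_UnI finite_subset by metis
  then show ?thesis
    by (simp add: minus_fseq_def coord_Abs)
qed

lemma coord_scaleR [simp]: "coord (c *\<^sub>R x) i = c * coord x i"
  by (cases "c = 0") (simp_all add: scaleR_fseq_def coord_Abs)

instance
  by standard (auto intro!: fseq_eqI simp: algebra_simps)

end

instantiation fseq :: real_inner
begin

definition inner_fseq :: "fseq \<Rightarrow> fseq \<Rightarrow> real" where
  "x \<bullet> y = (\<Sum>i | coord x i \<noteq> 0. coord x i * coord y i)"

definition norm_fseq :: "fseq \<Rightarrow> real" where
  "norm (x :: fseq) = sqrt (x \<bullet> x)"

definition sgn_fseq :: "fseq \<Rightarrow> fseq" where
  "sgn (x :: fseq) = x /\<^sub>R norm x"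

definition dist_fseq :: "fseq \<Rightarrow> fseq \<Rightarrow> real" where
  "dist (x :: fseq) y = norm (x - y)"

definition uniformity_fseq :: "(fseq \<times> fseq) filter" where
  "uniformity = (INF e\<in>{0<..}. principal {(x :: fseq, y). dist x y < e})"

definition open_fseq :: "fseq set \<Rightarrow> bool" where
  "open (U :: fseq set) \<longleftrightarrow> (\<forall>x\<in>U. eventually (\<lambda>(x', y). x' = x \<longrightarrow> y \<in> U) uniformity)"

lemma inner_fseq_on:
  assumes "finite A" "{i. coord x i \<noteq> 0} \<subseteq> A"
  shows "x \<bullet> y = (\<Sum>i\<in>A. coord x i * coord y i)"
  unfolding inner_fseq_def using assms by (intro sum.mono_neutral_left) auto

instance
proof
  fix x y z :: fseq and r :: real
  let ?A = "{i. coord x i \<noteq> 0} \<union> {i. coord y i \<noteq> 0}"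
  have A: "finite ?A" by simp
  show "x \<bullet> y = y \<bullet> x"
    using inner_fseq_on[OF A, of x y] inner_fseq_on[OF A, of y x] by (simp add: mult.commute)
  have xy: "{i. coord (x + y) i \<noteq> 0} \<subseteq> ?A" by auto
  show "(x + y) \<bullet> z = x \<bullet> z + y \<bullet> z"
    using inner_fseq_on[OF A xy, of z] inner_fseq_on[OF A, of x z] inner_fseq_on[OF A, of y z]
    by (simp add: sum.distrib distrib_right)
  have rx: "{i. coord (r *\<^sub>R x) i \<noteq> 0} \<subseteq> ?A" by auto
  show "r *\<^sub>R x \<bullet> y = r * (x \<bullet> y)"
    using inner_fseq_on[OF A rx, of y] inner_fseq_on[OF A, of x y]
    by (simp add: sum_distrib_left mult.assoc)
  show "0 \<le> x \<bullet> x"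
    unfolding inner_fseq_def by (intro sum_nonneg) simp
  show "x \<bullet> x = 0 \<longleftrightarrow> x = 0"
    unfolding inner_fseq_def by (subst sum_nonneg_eq_0_iff) (auto intro: fseq_eqI)
  show "norm (x :: fseq) = sqrt (x \<bullet> x)"
    by (fact norm_fseq_def)
  show "sgn x = x /\<^sub>R norm x"
    by (fact sgn_fseq_def)
  show "dist x y = norm (x - y)"
    by (fact dist_fseq_def)
  show "uniformity = (INF e\<in>{0<..}. principal {(x::fseq, y). dist x y < e})"
    by (fact uniformity_fseq_def)
  show "open U \<longleftrightarrow> (\<forall>x\<in>U. eventually (\<lambda>(x', y). x' = x \<longrightarrow> y \<in> U) uniformity)"
    for U :: "fseq set"
    by (fact open_fseq_def)
qed

end

definition Rn :: "nat \<Rightarrow> fseq set" where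
  "Rn m = {x. \<forall>i\<ge>m. coord x i = 0}"

lemma inner_Rn: "x \<in> Rn m \<Longrightarrow> x \<bullet> y = (\<Sum>i<m. coord x i * coord y i)"
  by (rule inner_fseq_on) (auto simp: Rn_def not_less[symmetric])

lemma subspace_Rn: "subspace (Rn m)"
  by (auto simp: subspace_def Rn_def)

definition Zn :: "nat \<Rightarrow> fseq set" where
  "Zn m = {k \<in> Rn m. \<forall>i. coord k i \<in> \<int>}"

abbreviation interior_Rn :: "nat \<Rightarrow> fseq set \<Rightarrow> fseq set" where
  "interior_Rn m S \<equiv> (top_of_set (Rn m)) interior_of S"

abbreviation boundary_Rn :: "nat \<Rightarrow> fseq set \<Rightarrow> fseq set" where
  "boundary_Rn m S \<equiv> (top_of_set (Rn m)) frontier_of S"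


definition has_gradient :: "nat \<Rightarrow> (fseq \<Rightarrow> real) \<Rightarrow> fseq \<Rightarrow> fseq \<Rightarrow> bool" where
  "has_gradient m f G x \<longleftrightarrow>
     G \<in> Rn m \<and> (f has_derivative (\<lambda>h. G \<bullet> h)) (at x within Rn m)"

text \<open>Functions of class $C^k$ on a relatively open subset of $R^m$: for positive $k$, differentiable
  with all first partial derivatives of class $C^{k-1}$.\<close>

primrec Ck_on :: "nat \<Rightarrow> nat \<Rightarrow> fseq set \<Rightarrow> (fseq \<Rightarrow> real) \<Rightarrow> bool" where
  "Ck_on 0 m U f \<longleftrightarrow> continuous_on U f"
| "Ck_on (Suc k) m U f \<longleftrightarrow>
     (\<exists>G. (\<forall>x\<in>U. has_gradient m f (G x) x) \<and> (\<forall>i<m. Ck_on k m U (\<lambda>x. coord (G x) i)))"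

text \<open>Near \<open>p\<close> the set \<open>S\<close> is the sublevel set of a smooth function \<open>f\<close> with nonzero gradient \<open>G\<close>
  at \<open>p\<close>.\<close>

definition local_defining_function ::
  "nat \<Rightarrow> fseq set \<Rightarrow> fseq \<Rightarrow> fseq set \<Rightarrow> (fseq \<Rightarrow> real) \<Rightarrow> fseq \<Rightarrow> bool" where
  "local_defining_function m S p U f G \<longleftrightarrow>
     openin (top_of_set (Rn m)) U \<and> p \<in> U \<and> (\<forall>k. Ck_on k m U f) \<and>
     S \<inter> U = {x \<in> U. f x \<le> 0} \<and> has_gradient m f G p \<and> G \<noteq> 0"

definition smooth_boundary :: "nat \<Rightarrow> fseq set \<Rightarrow> bool" where
  "smooth_boundary m S \<longleftrightarrow>
     (\<forall>p\<in>boundary_Rn m S. \<exists>U f G. local_defining_function m S p U f G)"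

definition outward_unit_normal :: "nat \<Rightarrow> fseq set \<Rightarrow> fseq \<Rightarrow> fseq \<Rightarrow> bool" where
  "outward_unit_normal m S p \<nu> \<longleftrightarrow>
     p \<in> boundary_Rn m S \<and> (\<exists>U f G. local_defining_function m S p U f G \<and> \<nu> = G /\<^sub>R norm G)"

definition strictly_convex :: "nat \<Rightarrow> fseq set \<Rightarrow> bool" where
  "strictly_convex m S \<longleftrightarrow>
     convex S \<and> (\<forall>a b. a \<noteq> b \<longrightarrow> \<not> closed_segment a b \<subseteq> boundary_Rn m S)"


text \<open>An obstacle on the torus is given by its lift \<open>S\<close> indexed by the zero vector.\<close>

definition lift :: "fseq set \<Rightarrow> fseq \<Rightarrow> fseq set" where
  "lift S k = (\<lambda>x. x + k) ` S"

definition obstacle :: "nat \<Rightarrow> fseq set \<Rightarrow> bool" where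
  "obstacle m S \<longleftrightarrow>
     S \<subseteq> Rn m \<and> compact S \<and> interior_Rn m S \<noteq> {} \<and> smooth_boundary m S \<and> strictly_convex m S \<and>
     (\<forall>k\<in>Zn m. \<forall>l\<in>Zn m. k \<noteq> l \<longrightarrow> lift S k \<inter> lift S l = {})"

definition small :: "fseq set \<Rightarrow> bool" where
  "small S \<longleftrightarrow> (\<exists>r < sqrt 2 / 4. S \<subseteq> cball 0 r)"

definition between :: "fseq set \<Rightarrow> fseq \<Rightarrow> fseq \<Rightarrow> fseq \<Rightarrow> bool" where
  "between S k i j \<longleftrightarrow>
     k \<noteq> i \<and> k \<noteq> j \<and> lift S k \<inter> convex hull (lift S i \<union> lift S j) \<noteq> {}"

definition admissible :: "nat \<Rightarrow> fseq set \<Rightarrow> nat \<Rightarrow> (nat \<Rightarrow> fseq) \<Rightarrow> bool" where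
  "admissible m S s k \<longleftrightarrow>
     (\<forall>n\<le>s. k n \<in> Zn m) \<and>
     k 0 = 0 \<and>
     (\<forall>n<s. k (n + 1) \<noteq> k n) \<and>
     (\<forall>n<s. \<forall>l\<in>Zn m. \<not> between S l (k n) (k (n + 1))) \<and>
     (\<forall>n. n + 2 \<le> s \<longrightarrow> \<not> between S (k (n + 1)) (k n) (k (n + 2)))"

text \<open>A billiard path coming from \<open>a\<close> hits the boundary of \<open>S\<close> at \<open>p\<close> and goes on towards \<open>b\<close>.
  The condition that \<open>u \<bullet> \<nu>\<close> is nonzero says that the path is not tangent to \<open>S\<close> at \<open>p\<close>.\<close>

definition reflects :: "nat \<Rightarrow> fseq set \<Rightarrow> fseq \<Rightarrow> fseq \<Rightarrow> fseq \<Rightarrow> bool" where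
  "reflects m S a p b \<longleftrightarrow>
     (\<exists>\<nu>. outward_unit_normal m S p \<nu> \<and>
        (let u = (p - a) /\<^sub>R norm (p - a); v = (b - p) /\<^sub>R norm (b - p)
         in u \<bullet> \<nu> \<noteq> 0 \<and> v = u - (2 * (u \<bullet> \<nu>)) *\<^sub>R \<nu>))"

text \<open>A trajectory piece is given by its initial point \<open>p 0\<close>, its reflection points
  \<open>p 1, \<dots>, p (s - 1)\<close> and its endpoint \<open>p s\<close>.  Between them it moves along straight segments,
  which may be tangent to other obstacles but do not enter the interior of any obstacle.\<close>

definition trajectory_piece ::
  "nat \<Rightarrow> fseq set \<Rightarrow> nat \<Rightarrow> (nat \<Rightarrow> fseq) \<Rightarrow> (nat \<Rightarrow> fseq) \<Rightarrow> bool" where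
  "trajectory_piece m S s q p \<longleftrightarrow>
     (\<forall>n\<le>s. p n \<in> boundary_Rn m (lift S (q n))) \<and>
     (\<forall>n<s. p n \<noteq> p (n + 1)) \<and>
     (\<forall>n<s. \<forall>l\<in>Zn m. closed_segment (p n) (p (n + 1)) \<inter> interior_Rn m (lift S l) = {}) \<and>
     (\<forall>n. 0 < n \<and> n < s \<longrightarrow> reflects m (lift S (q n)) (p (n - 1)) (p n) (p (n + 1)))"

text \<open>The type of a piece is normalised to start at the zero vector, so the obstacles that the piece
  actually visits are those indexed by \<open>a + k n\<close> for some lattice vector \<open>a\<close>.\<close>

definition admissible_piece ::
  "nat \<Rightarrow> fseq set \<Rightarrow> fseq \<Rightarrow> fseq \<Rightarrow> real \<Rightarrow> bool" where
  "admissible_piece m S x y t \<longleftrightarrow>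
     (\<exists>s k a p. admissible m S s k \<and> a \<in> Zn m \<and> trajectory_piece m S s (\<lambda>n. a + k n) p \<and>
        x = p 0 \<and> y = p s \<and> t = (\<Sum>n<s. dist (p n) (p (n + 1))))"

definition admissible_rotation_set :: "nat \<Rightarrow> fseq set \<Rightarrow> fseq set" where
  "admissible_rotation_set m S =
     {v \<in> Rn m. \<exists>x y t. (\<forall>n. admissible_piece m S (x n) (y n) (t n)) \<and>
        filterlim t at_top sequentially \<and> (\<lambda>n. (y n - x n) /\<^sub>R t n) \<longlonglongrightarrow> v}"

definition largest_ball_radius :: "nat \<Rightarrow> fseq set \<Rightarrow> real \<Rightarrow> bool" where
  "largest_ball_radius m A \<rho> \<longleftrightarrow>
     0 \<le> \<rho> \<and> cball 0 \<rho> \<inter> Rn m \<subseteq> A \<and> (\<forall>r. cball 0 r \<inter> Rn m \<subseteq> A \<longrightarrow> r \<le> \<rho>)"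

end

theory Submission
  imports Defs
begin

text \<open>
  A displacement is never longer than the time it takes, so the admissible rotation set is contained
  in the unit ball.  It is closed, so a largest ball exists as soon as the set contains some ball, and
  it suffices to find all vectors of norm at most \<open>1 - \<epsilon>\<close> in it.

  Every admissible sequence is the type of a trajectory piece (\<open>shortest_chain_is_trajectory\<close>):
  minimise the length of a polygonal chain with one vertex in each obstacle of the sequence.
  Admissibility makes the minimiser turn at each vertex and keeps its edges away from
  other obstacles, and the first order condition at a vertex is the reflection law.  For an obstacle
  of diameter less than \<open>\<delta>\<close>, the length of an edge differs from the length of the corresponding lattice
  step by at most \<open>\<delta>\<close>.

  What remains is a problem about lattice paths: given a lattice vector \<open>K\<close>, find an admissible sequence
  from \<open>0\<close> to a fixed multiple of \<open>K\<close> that is almost straight, uniformly in the dimension.  Call a lattice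
  vector visible if no lattice point other than its endpoints comes close to the segment from \<open>0\<close> to it.
  \<^item> Steps that are visible and such that consecutive ones differ form an admissible sequence,
    however long they are (\<open>admissible_of_visible_steps\<close>).
  \<^item> Every lattice vector is a sum of visible ones whose lengths add up to hardly more than its own
    length: subdivide at nearby lattice points as often as possible (\<open>visible_decomposition\<close>).  As all
    steps have length at least 1, the excess is a small proportion of the length in any dimension.
  \<^item> Repetitions are avoided at a small proportional cost (\<open>nearly_straight_steps\<close>).  After a step of
    length at least \<open>L\<close> insert a detour forth and back along a unit vector; replace a long multiple of a
    shorter step by a slightly perturbed one, which is visible if \<open>\<delta>\<close> is small in terms of \<open>L\<close> alone.

  Vectors of norm at most \<open>1 - \<epsilon>\<close> are approached by wasting the remaining time between two
  neighbouring obstacles (\<open>admissible_piece_exists\<close>).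
\<close>

section \<open>Integer vectors\<close>

definition axis_vec :: "nat \<Rightarrow> fseq" where
  "axis_vec i = Abs_fseq (\<lambda>j. if j = i then 1 else 0)"

lemma coord_axis_vec: "coord (axis_vec i) j = (if j = i then 1 else 0)"
  unfolding axis_vec_def by (subst coord_Abs) auto

lemma inner_axis_vec: "axis_vec i \<bullet> x = coord x i"
  by (subst inner_fseq_on[of "{i}"]) (auto simp: coord_axis_vec)

lemma norm_axis_vec [simp]: "norm (axis_vec i) = 1"
  by (simp add: norm_eq_sqrt_inner inner_axis_vec coord_axis_vec)

lemma axis_vec_nonzero [simp]: "axis_vec i \<noteq> 0"
  by (metis norm_axis_vec norm_zero zero_neq_one)

lemma abs_coord_le_norm: "\<bar>coord x i\<bar> \<le> norm x"
  using Cauchy_Schwarz_ineq2[of "axis_vec i" x] by (simp add: inner_axis_vec)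

lemma norm_le_sqrt_of_coord_le_1:
  assumes "x \<in> Rn m" "\<And>i. \<bar>coord x i\<bar> \<le> 1"
  shows "norm x \<le> sqrt m"
proof -
  have "x \<bullet> x = (\<Sum>i<m. coord x i * coord x i)"
    by (rule inner_Rn[OF assms(1)])
  also have "\<dots> \<le> (\<Sum>i<m. 1)"
    by (rule sum_mono) (metis assms(2) abs_square_le_1 power2_eq_square)
  finally show ?thesis
    by (simp add: norm_eq_sqrt_inner)
qed

lemma Zn_closed [simp, intro]:
  "0 \<in> Zn m"
  "k \<in> Zn m \<Longrightarrow> l \<in> Zn m \<Longrightarrow> k + l \<in> Zn m"
  "k \<in> Zn m \<Longrightarrow> l \<in> Zn m \<Longrightarrow> k - l \<in> Zn m"
  "k \<in> Zn m \<Longrightarrow> - k \<in> Zn m"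
  "k \<in> Zn m \<Longrightarrow> of_nat n *\<^sub>R k \<in> Zn m"
  "i < m \<Longrightarrow> axis_vec i \<in> Zn m"
  by (auto simp: Zn_def Rn_def coord_axis_vec)

lemma Zn_subset_Rn: "k \<in> Zn m \<Longrightarrow> k \<in> Rn m"
  by (simp add: Zn_def)

lemma Zn_nonzero_coord:
  assumes "k \<in> Zn m" "k \<noteq> 0"
  obtains i where "i < m" "coord k i \<noteq> 0"
  using assms fseq_eqI[of k 0] unfolding Zn_def Rn_def
  by (metis (mono_tags, lifting) coord_zero linorder_not_less mem_Collect_eq)

lemma Zn_abs_coord_ge_1: "k \<in> Zn m \<Longrightarrow> coord k i \<noteq> 0 \<Longrightarrow> 1 \<le> \<bar>coord k i\<bar>"
  using Ints_nonzero_abs_ge1 by (auto simp: Zn_def)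

lemma Zn_norm_ge_1:
  assumes "k \<in> Zn m" "k \<noteq> 0"
  shows "1 \<le> norm k"
  using Zn_nonzero_coord[OF assms] Zn_abs_coord_ge_1[OF assms(1)] abs_coord_le_norm
  by (metis order_trans)

lemma int_minus_unit_interval_ge_1:
  assumes "c \<in> \<int>" "c \<noteq> 0" "c \<noteq> 1" "0 \<le> t" "t \<le> (1::real)"
  shows "1 \<le> \<bar>c - t\<bar>"
proof -
  obtain n :: int where n: "c = of_int n"
    using assms(1) Ints_cases by blast
  then have "n \<le> -1 \<or> 2 \<le> n"
    using assms by auto
  then show ?thesis
    using assms n by auto
qed

section \<open>Visible vectors\<close>

text \<open>A step \<open>u\<close> of the itinerary may be made between two obstacles of diameter less than \<open>\<eta>\<close>
  without any other obstacle being between them.  Distances are measured from lattice points rather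
  than from obstacles, so that everything about itineraries becomes lattice geometry.\<close>

definition visible :: "nat \<Rightarrow> real \<Rightarrow> fseq \<Rightarrow> bool" where
  "visible m \<eta> u \<longleftrightarrow> u \<in> Zn m \<and> u \<noteq> 0 \<and>
     (\<forall>l\<in>Zn m. \<forall>t\<in>{0..1}. l \<noteq> 0 \<longrightarrow> l \<noteq> u \<longrightarrow> \<eta> \<le> norm (l - t *\<^sub>R u))"

lemma visible_uminus:
  assumes "visible m \<eta> u"
  shows "visible m \<eta> (- u)"
  unfolding visible_def
proof (intro conjI ballI impI)
  fix l and t :: real
  assume *: "l \<in> Zn m" "t \<in> {0..1}" "l \<noteq> 0" "l \<noteq> - u"
  then have "- l \<in> Zn m" "- l \<noteq> 0" "- l \<noteq> u"
    by (auto simp: minus_equation_iff)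
  then have "\<eta> \<le> norm (- l - t *\<^sub>R u)"
    using assms *(2) unfolding visible_def by blast
  also have "- l - t *\<^sub>R u = - (l - t *\<^sub>R (- u))"
    by simp
  finally show "\<eta> \<le> norm (l - t *\<^sub>R (- u))"
    by (metis norm_minus_cancel)
qed (use assms in \<open>auto simp: visible_def\<close>)

lemma visible_axis_vec:
  assumes "i < m" "\<eta> \<le> 1"
  shows "visible m \<eta> (axis_vec i)"
  unfolding visible_def
proof (intro conjI ballI impI)
  fix l and t :: real
  assume l: "l \<in> Zn m" "t \<in> {0..1}" "l \<noteq> 0" "l \<noteq> axis_vec i"
  have "\<exists>j. 1 \<le> \<bar>coord (l - t *\<^sub>R axis_vec i) j\<bar>"
  proof (cases "\<exists>j. j \<noteq> i \<and> coord l j \<noteq> 0")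
    case True
    then show ?thesis
      using Zn_abs_coord_ge_1[OF l(1)] by (auto simp: coord_axis_vec)
  next
    case False
    then have "coord l i \<noteq> 0" "coord l i \<noteq> 1"
      using l(3,4) by (metis fseq_eqI coord_zero, metis fseq_eqI coord_axis_vec)
    then have "1 \<le> \<bar>coord l i - t\<bar>"
      using l(1,2) int_minus_unit_interval_ge_1 by (auto simp: Zn_def)
    then show ?thesis
      by (auto intro!: exI[of _ i] simp: coord_axis_vec)
  qed
  then show "\<eta> \<le> norm (l - t *\<^sub>R axis_vec i)"
    using assms(2) abs_coord_le_norm by (metis order_trans)
qed (use assms in auto)

text \<open>If a lattice point \<open>l\<close> is within \<open>\<eta>\<close> of the segment from \<open>0\<close> to \<open>w\<close>, all the \<open>2 \<times> 2\<close> minors of the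
  pair \<open>(l, w)\<close> are at most \<open>2 * \<eta> * norm w\<close>, so they are integers of modulus below 1 and vanish.  Hence
  \<open>l\<close> is parallel to \<open>w\<close>, and two coprime entries of \<open>w\<close> make it an integer multiple of \<open>w\<close>.\<close>

lemma visible_if_short_and_coprime:
  assumes w: "w \<in> Zn m" and cop: "coprime a b" "coord w i = of_int a" "coord w j = of_int b"
    and b: "b \<noteq> 0" and short: "2 * \<eta> * norm w < 1" and \<eta>: "\<eta> \<le> 1"
  shows "visible m \<eta> w"
  unfolding visible_def
proof (intro conjI ballI impI w)
  show "w \<noteq> 0"
    using b cop(3) by auto
  fix l and t :: real
  assume l: "l \<in> Zn m" "t \<in> {0..1}" "l \<noteq> 0" "l \<noteq> w"
  show "\<eta> \<le> norm (l - t *\<^sub>R w)"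
  proof (rule ccontr)
    assume "\<not> \<eta> \<le> norm (l - t *\<^sub>R w)"
    define d where "d = l - t *\<^sub>R w"
    have d: "norm d < \<eta>"
      using \<open>\<not> \<eta> \<le> norm (l - t *\<^sub>R w)\<close> by (simp add: d_def)
    \<comment> \<open>The multiple \<open>t *\<^sub>R w\<close> drops out of each minor, which leaves only the small difference \<open>d\<close>.\<close>
    have minors: "coord l x * coord w y = coord l y * coord w x" for x y
    proof -
      have eq: "coord l x * coord w y - coord l y * coord w x
          = coord d x * coord w y - coord d y * coord w x"
        by (simp add: d_def algebra_simps)
      have le: "\<bar>coord d x' * coord w y'\<bar> \<le> \<eta> * norm w" for x' y'
        unfolding abs_mult
        by (rule mult_mono) (use d abs_coord_le_norm[of d x'] abs_coord_le_norm[of w y'] in auto)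
      have "\<bar>coord l x * coord w y - coord l y * coord w x\<bar> < 1"
        using short le[of x y] le[of y x] unfolding eq by linarith
      moreover have "coord l x * coord w y - coord l y * coord w x \<in> \<int>"
        using l(1) w by (auto simp: Zn_def)
      ultimately show ?thesis
        using Ints_nonzero_abs_less1 by fastforce
    qed
    obtain c where c: "coord l j = of_int c" 
      using l(1) Ints_cases by (auto simp: Zn_def)
    obtain c' where c': "coord l i = of_int c'"
      using l(1) Ints_cases by (auto simp: Zn_def)
    have "of_int (c * a) = (of_int (c' * b) :: real)"
      using minors[of j i] cop c c' by simp
    then have "b dvd c * a"
      by (metis dvd_triv_right of_int_eq_iff)
    then have "b dvd c"
      using cop(1) by (simp add: coprime_commute coprime_dvd_mult_left_iff)
    then obtain q where q: "c = b * q" ..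
    have lw: "l = of_int q *\<^sub>R w"
    proof (rule fseq_eqI)
      fix x
      have "coord l x * of_int b = of_int b * of_int q * coord w x"
        using minors[of x j] c cop(3) q by simp
      then show "coord l x = coord (of_int q *\<^sub>R w) x"
        using b by simp
    qed
    then have "q \<noteq> 0" "q \<noteq> 1"
      using l(3,4) by auto
    then have "1 \<le> \<bar>of_int q - t\<bar>"
      using l(2) int_minus_unit_interval_ge_1[of "of_int q" t] by auto
    moreover have "1 \<le> norm w"
      using Zn_norm_ge_1 w \<open>w \<noteq> 0\<close> by blast
    moreover have "norm d = \<bar>of_int q - t\<bar> * norm w"
      by (simp add: d_def lw flip: scaleR_left_diff_distrib)
    ultimately show False
      using d \<eta> mult_mono[of 1 "\<bar>of_int q - t\<bar>" 1 "norm w"] by linarith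
  qed
qed

text \<open>As long as some lattice point \<open>l\<close> is within \<open>\<eta>\<close> of the segment from \<open>0\<close> to \<open>K\<close>, split \<open>K\<close> into \<open>l\<close> and
  \<open>K - l\<close>.  One splitting lengthens the path by at most \<open>2 * \<eta>\<close> and adds one step.  Since every step
  has length at least 1, the number of steps, and with it the total excess, is under control whatever
  the dimension: counting each step with the rebate \<open>2 * \<eta>\<close>, splitting never increases the total.\<close>

lemma visible_decomposition:
  assumes "K \<in> Zn m" "0 < \<eta>" "4 * \<eta> \<le> 1"
  shows "\<exists>us. (\<forall>u\<in>set us. visible m \<eta> u) \<and> sum_list us = K \<and>
           (\<Sum>u\<leftarrow>us. norm u - 2 * \<eta>) \<le> norm K"
proof -
  have "\<forall>K. K \<in> Zn m \<longrightarrow> K \<noteq> 0 \<longrightarrow> norm K \<le> n / 2 \<longrightarrow>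
      (\<exists>us. (\<forall>u\<in>set us. visible m \<eta> u) \<and> sum_list us = K \<and>
           (\<Sum>u\<leftarrow>us. norm u - 2 * \<eta>) \<le> norm K - 2 * \<eta>)" for n :: nat
  proof (induction n)
    case 0
    then show ?case by auto
  next
    case (Suc n)
    show ?case
    proof (intro allI impI)
      fix K assume K: "K \<in> Zn m" "K \<noteq> 0" "norm K \<le> Suc n / 2"
      show "\<exists>us. (\<forall>u\<in>set us. visible m \<eta> u) \<and> sum_list us = K \<and>
           (\<Sum>u\<leftarrow>us. norm u - 2 * \<eta>) \<le> norm K - 2 * \<eta>"
      proof (cases "visible m \<eta> K")
        case True
        then show ?thesis
          by (intro exI[of _ "[K]"]) auto
      next
        case False
        then obtain l t where l: "l \<in> Zn m" "0 \<le> t" "t \<le> 1" "l \<noteq> 0" "l \<noteq> K"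
          "norm (l - t *\<^sub>R K) < \<eta>"
          using K by (auto simp: visible_def not_le)
        have "norm l \<le> norm (t *\<^sub>R K) + norm (l - t *\<^sub>R K)"
          by (metis add_diff_cancel_left' diff_add_cancel norm_triangle_ineq add.commute)
        then have 1: "norm l \<le> t * norm K + \<eta>"
          using l by simp
        have "K - l = (1 - t) *\<^sub>R K - (l - t *\<^sub>R K)"
          by (simp add: algebra_simps)
        then have "norm (K - l) \<le> norm ((1 - t) *\<^sub>R K) + norm (l - t *\<^sub>R K)"
          by (metis norm_triangle_ineq4)
        then have 2: "norm (K - l) \<le> (1 - t) * norm K + \<eta>"
          using l by simp
        have sum: "norm l + norm (K - l) \<le> norm K + 2 * \<eta>"
          using 1 2 by (simp add: algebra_simps)
        \<comment> \<open>Each part is at least \<open>1 - 2 * \<eta> \<ge> 1 / 2\<close> shorter than \<open>K\<close>, as the other one has length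
          at least 1; this makes the induction on half-integer bounds for the norm work.\<close>
        have ge: "1 \<le> norm l" "1 \<le> norm (K - l)"
          using l K Zn_norm_ge_1[of l m] Zn_norm_ge_1[of "K - l" m] by auto
        have "norm l \<le> n / 2" "norm (K - l) \<le> n / 2"
          using sum ge K(3) assms by (auto simp: field_simps)
        note small = this
        obtain us where us: "\<forall>u\<in>set us. visible m \<eta> u" "sum_list us = l"
           "(\<Sum>u\<leftarrow>us. norm u - 2 * \<eta>) \<le> norm l - 2 * \<eta>"
          using Suc.IH[rule_format, of l] l small by blast
        obtain vs where vs: "\<forall>u\<in>set vs. visible m \<eta> u" "sum_list vs = K - l"
           "(\<Sum>u\<leftarrow>vs. norm u - 2 * \<eta>) \<le> norm (K - l) - 2 * \<eta>"
          using Suc.IH[rule_format, of "K - l"] l K(1) small Zn_closed(3) by force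
        show ?thesis
          by (intro exI[of _ "us @ vs"]) (use us vs sum in auto)
      qed
    qed
  qed
  note * = this[of "nat \<lceil>2 * norm K\<rceil>"]
  show ?thesis
  proof (cases "K = 0")
    case True
    then show ?thesis
      by (intro exI[of _ "[]"]) auto
  next
    case False
    have "norm K \<le> nat \<lceil>2 * norm K\<rceil> / 2"
      by linarith
    then show ?thesis
      using * assms False by force
  qed
qed

lemma coprime_Suc_mult:
  fixes M x y :: int
  assumes "y dvd M"
  shows "coprime (M * x + 1) (M * y)"
proof -
  have "coprime (M * x + 1) M"
    by (metis add.commute coprime_1_left coprime_commute coprime_iff_gcd_eq_1 gcd_add_mult mult.commute)
  moreover from this assms have "coprime (M * x + 1) y"
    using coprime_divisors dvd_refl by blast
  ultimately show ?thesis
    by simp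
qed

text \<open>A short visible vector \<open>u\<close> cannot be used twice in a row, but a long multiple of it can be replaced
  by a nearly parallel vector that is visible again.  The factor \<open>fact L\<close> is divisible by every
  nonzero entry of \<open>u\<close>, which makes the entry \<open>fact L * u\<^sub>i + 1\<close> coprime to the entry \<open>fact L * u\<^sub>j\<close>, and it does not
  depend on \<open>u\<close>.\<close>

lemma visible_perturbed_multiple:
  assumes u: "u \<in> Zn m" "u \<noteq> 0" "norm u \<le> L" and m: "2 \<le> m" and \<eta>: "0 < \<eta>" "\<eta> \<le> 1"
    and short: "2 * \<eta> * (fact L * L + 1) < 1"
  obtains i where "i < m" "visible m \<eta> (fact L *\<^sub>R u + axis_vec i)"
proof -
  obtain j where j: "j < m" "coord u j \<noteq> 0"
    using Zn_nonzero_coord u by blast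
  obtain i where i: "i < m" "i \<noteq> j"
    using m that[of 0] that[of 1] by fastforce
  obtain x y where x: "coord u i = of_int x" and y: "coord u j = of_int y"
    using u(1) unfolding Zn_def by (metis (mono_tags, lifting) Ints_cases mem_Collect_eq)
  have y0: "y \<noteq> 0"
    using j y by auto
  have "of_int \<bar>y\<bar> \<le> (of_int (int L) :: real)"
    using abs_coord_le_norm[of u j] y u(3) by simp
  then have "\<bar>y\<bar> \<le> int L"
    by (simp only: of_int_le_iff)
  then have "nat \<bar>y\<bar> dvd fact L"
    using y0 by (intro dvd_fact) auto
  then have dvd: "y dvd fact L"
    by (metis abs_dvd_iff int_dvd_int_iff int_nat_eq of_nat_fact abs_ge_zero)
  let ?w = "fact L *\<^sub>R u + axis_vec i"
  have "norm ?w \<le> fact L * norm u + 1"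
    using norm_triangle_ineq[of "fact L *\<^sub>R u" "axis_vec i"] by simp
  also have "\<dots> \<le> fact L * L + 1"
    using u(3) by simp
  finally have nw: "norm ?w \<le> fact L * L + 1" .
  have "visible m \<eta> ?w"
  proof (rule visible_if_short_and_coprime)
    show "?w \<in> Zn m"
      using Zn_closed(2)[OF Zn_closed(5)[OF u(1), of "fact L"] Zn_closed(6)[OF i(1)]] by simp
    show "coprime (fact L * x + 1) (fact L * y)"
      by (rule coprime_Suc_mult[OF dvd])
    show "coord ?w i = of_int (fact L * x + 1)" "coord ?w j = of_int (fact L * y)"
      using x y i by (auto simp: coord_axis_vec)
    show "2 * \<eta> * norm ?w < 1"
      using mult_left_mono[OF nw, of "2 * \<eta>"] short \<eta> by linarith
  qed (use y0 \<eta> in auto)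
  then show ?thesis
    using that i by blast
qed

section \<open>Nearly straight sequences of steps\<close>

lemma repeated_step_with_detour:
  fixes u e :: fseq
  assumes "u \<noteq> e" "u \<noteq> - e" "e \<noteq> 0" "norm e = 1"
  defines "B \<equiv> \<lambda>n. concat (replicate (Suc n) [u, e, - e])"
  shows "distinct_adj (B n)" "hd (B n) = u" "last (B n) = - e" "B n \<noteq> []"
    "sum_list (B n) = real (Suc n) *\<^sub>R u" "(\<Sum>w\<leftarrow>B n. norm w) = real (Suc n) * (norm u + 2)"
    "set (B n) = {u, e, - e}"
proof -
  have e: "e \<noteq> - e"
    using assms(3) by (metis add.right_inverse scaleR_2 scaleR_eq_0_iff zero_neq_numeral)
  have B_Suc: "B (Suc n) = u # e # - e # B n" for n
    by (simp add: B_def)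
  have B_0: "B 0 = [u, e, - e]"
    by (simp add: B_def)
  have ne: "B n \<noteq> []" for n
    by (cases n) (simp_all add: B_0 B_Suc)
  have hd: "hd (B n) = u" for n
    by (cases n) (simp_all add: B_0 B_Suc)
  show "B n \<noteq> []" "hd (B n) = u"
    by (fact ne, fact hd)
  show "last (B n) = - e"
    by (induction n) (simp_all add: B_0 B_Suc ne)
  show "distinct_adj (B n)"
  proof (induction n)
    case (Suc n)
    then show ?case
      using e assms(1,2) ne[of n] hd[of n] unfolding B_Suc by (metis distinct_adj_Cons list.sel(1))
  qed (use e assms(1) in \<open>simp add: B_0\<close>)
  show "sum_list (B n) = real (Suc n) *\<^sub>R u"
    by (induction n) (simp_all add: B_0 B_Suc algebra_simps scaleR_2)
  show "(\<Sum>w\<leftarrow>B n. norm w) = real (Suc n) * (norm u + 2)"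
    by (induction n) (simp_all add: B_0 B_Suc assms(4) algebra_simps)
  show "set (B n) = {u, e, - e}"
    by (induction n) (auto simp: B_0 B_Suc)
qed

text \<open>The multiple \<open>fact L *\<^sub>R u\<close> is realised without repeating a step twice in a row, at a relative cost of
  \<open>2 / L\<close>.  If \<open>u\<close> is long, a detour forth and back along a unit vector after each \<open>u\<close> is cheap.  If \<open>u\<close>
  is short, the whole multiple is walked in one perturbed step, which a unit vector corrects.  In both
  cases the list starts with a step longer than 1 and ends with a unit vector, so that such lists can
  be concatenated.\<close>

lemma scaled_visible_vector_as_steps:
  assumes u: "visible m \<eta> u" and m: "2 \<le> m" and L: "3 \<le> L" and \<eta>: "0 < \<eta>" "\<eta> \<le> 1"
    and short: "2 * \<eta> * (fact L * L + 1) < 1"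
  shows "\<exists>B. B \<noteq> [] \<and> (\<forall>w\<in>set B. visible m \<eta> w) \<and> distinct_adj B \<and> 1 < norm (hd B) \<and>
           (\<exists>i. last B = - axis_vec i) \<and> sum_list B = fact L *\<^sub>R u \<and>
           (\<Sum>w\<leftarrow>B. norm w) \<le> (1 + 2 / L) * (fact L * norm u)"
proof (cases "L \<le> norm u")
  case True
  define e where "e = axis_vec 0"
  obtain M where M: "fact L = Suc M"
    by (metis fact_nonzero not0_implies_Suc)
  then have Mr: "real (Suc M) = fact L"
    by (metis of_nat_fact)
  define B where "B = concat (replicate (Suc M) [u, e, - e])"
  have ne: "u \<noteq> e" "u \<noteq> - e" "e \<noteq> 0" "norm e = 1"
    using True L by (auto simp: e_def)
  note B = repeated_step_with_detour[OF ne, where n = M, folded B_def]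
  have "visible m \<eta> e"
    unfolding e_def by (rule visible_axis_vec) (use m \<eta> in auto)
  then have "\<forall>w\<in>set B. visible m \<eta> w"
    using B(7) u visible_uminus by auto
  moreover have "norm u + 2 \<le> (1 + 2 / L) * norm u"
    using True L by (simp add: field_simps)
  then have "(\<Sum>w\<leftarrow>B. norm w) \<le> (1 + 2 / L) * (fact L * norm u)"
    unfolding B(6) Mr by (metis fact_ge_zero mult.left_commute mult_left_mono)
  moreover have "1 < norm (hd B)"
    using B(2) True L by simp
  ultimately show ?thesis
    using B Mr by (intro exI[of _ B] conjI) (auto simp: e_def)
next
  case False
  obtain i where i: "i < m" "visible m \<eta> (fact L *\<^sub>R u + axis_vec i)"
    using visible_perturbed_multiple[of u m L \<eta>] u False m \<eta> short by (auto simp: visible_def)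
  define w where "w = fact L *\<^sub>R u + axis_vec i"
  have u1: "1 \<le> norm u"
    using u Zn_norm_ge_1 by (auto simp: visible_def)
  have "L \<le> (fact L :: nat)"
    by (rule fact_ge_self)
  then have L_le: "L \<le> (fact L :: real)"
    by (metis of_nat_fact of_nat_le_iff)
  have Mu: "L \<le> fact L * norm u"
    using L_le mult_left_mono[OF u1, of "fact L"] by (metis fact_ge_zero mult.right_neutral order_trans)
  have nw: "norm w \<le> fact L * norm u + 1"
    using norm_triangle_ineq[of "fact L *\<^sub>R u" "axis_vec i"] by (simp add: w_def)
  have "fact L * norm u \<le> norm w + 1"
    using norm_triangle_ineq4[of w "axis_vec i"] by (simp add: w_def)
  then have w1: "1 < norm w"
    using Mu L by simp
  then have "w \<noteq> - axis_vec i"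
    by auto
  moreover have "visible m \<eta> (- axis_vec i)"
    by (intro visible_uminus visible_axis_vec) (use i \<eta> in auto)
  moreover have "2 \<le> 2 / L * (fact L * norm u)"
    using Mu L by (simp add: field_simps)
  then have "norm w + 1 \<le> (1 + 2 / L) * (fact L * norm u)"
    using nw by (simp add: distrib_right)
  ultimately show ?thesis
    using i w1 by (intro exI[of _ "[w, - axis_vec i]"]) (auto simp: w_def)
qed

lemma scaled_visible_sum_as_steps:
  assumes us: "\<forall>u\<in>set us. visible m \<eta> u"
    and m: "2 \<le> m" and L: "3 \<le> L" and \<eta>: "0 < \<eta>" "\<eta> \<le> 1"
    and short: "2 * \<eta> * (fact L * L + 1) < 1"
  shows "\<exists>W. (\<forall>w\<in>set W. visible m \<eta> w) \<and> distinct_adj W \<and> (W \<noteq> [] \<longrightarrow> 1 < norm (hd W)) \<and>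
           (W \<noteq> [] \<longrightarrow> (\<exists>i. last W = - axis_vec i)) \<and> sum_list W = fact L *\<^sub>R sum_list us \<and>
           (\<Sum>w\<leftarrow>W. norm w) \<le> (1 + 2 / L) * (fact L * (\<Sum>u\<leftarrow>us. norm u))"
  using us
proof (induction us)
  case Nil
  show ?case
    by (intro exI[of _ "[]"]) auto
next
  case (Cons u us)
  then obtain W where W: "\<forall>w\<in>set W. visible m \<eta> w" "distinct_adj W"
    "W \<noteq> [] \<longrightarrow> 1 < norm (hd W)" "W \<noteq> [] \<longrightarrow> (\<exists>i. last W = - axis_vec i)"
    "sum_list W = fact L *\<^sub>R sum_list us"
    "(\<Sum>w\<leftarrow>W. norm w) \<le> (1 + 2 / L) * (fact L * (\<Sum>u\<leftarrow>us. norm u))"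
    by auto
  obtain B where B: "B \<noteq> []" "\<forall>w\<in>set B. visible m \<eta> w" "distinct_adj B" "1 < norm (hd B)"
    "\<exists>i. last B = - axis_vec i" "sum_list B = fact L *\<^sub>R u"
    "(\<Sum>w\<leftarrow>B. norm w) \<le> (1 + 2 / L) * (fact L * norm u)"
    using scaled_visible_vector_as_steps[OF _ m L \<eta> short, of u] Cons.prems by auto
  have "W \<noteq> [] \<longrightarrow> last B \<noteq> hd W"
    using B(5) W(3) by (metis less_irrefl norm_axis_vec norm_minus_cancel)
  then have "distinct_adj (B @ W)"
    using B(3) W(2) by (subst distinct_adj_append_iff) blast
  moreover have "(\<Sum>w\<leftarrow>B @ W. norm w) \<le> (1 + 2 / L) * (fact L * (\<Sum>u\<leftarrow>u # us. norm u))"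
    using add_mono[OF B(7) W(6)] by (simp add: distrib_left)
  moreover have "sum_list (B @ W) = fact L *\<^sub>R sum_list (u # us)"
    using B(6) W(5) by (simp add: scaleR_add_right)
  moreover have "\<exists>i. last (B @ W) = - axis_vec i"
    using B(5) W(4) by (cases "W = []") auto
  ultimately show ?case
    using B(1,2,4) W(1) by (intro exI[of _ "B @ W"]) auto
qed

text \<open>The factor \<open>fact L\<close> is the same for all \<open>K\<close>, so it disappears from the limit of
  displacement over time.  The condition on the last step allows one to go on with \<open>axis_vec 0\<close>.\<close>

proposition nearly_straight_steps:
  assumes K: "K \<in> Zn m" and m: "2 \<le> m" and L: "3 \<le> L" and \<eta>: "0 < \<eta>" "4 * \<eta> \<le> 1"
    and short: "2 * \<eta> * (fact L * L + 1) < 1"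
  shows "\<exists>W. (\<forall>w\<in>set W. visible m \<eta> w) \<and> distinct_adj W \<and> (W \<noteq> [] \<longrightarrow> last W \<noteq> axis_vec 0) \<and>
           sum_list W = fact L *\<^sub>R K \<and>
           (1 - 2 * \<eta>) * (\<Sum>w\<leftarrow>W. norm w) \<le> (1 + 2 / L) * (fact L * norm K)"
proof -
  obtain us where us: "\<forall>u\<in>set us. visible m \<eta> u" "sum_list us = K"
    "(\<Sum>u\<leftarrow>us. norm u - 2 * \<eta>) \<le> norm K"
    using visible_decomposition[OF K \<eta>] by blast
  \<comment> \<open>The rebate \<open>2 * \<eta>\<close> per step is at most the fraction \<open>2 * \<eta>\<close> of the length of the step.\<close>
  have "(1 - 2 * \<eta>) * (\<Sum>u\<leftarrow>us. norm u) = (\<Sum>u\<leftarrow>us. (1 - 2 * \<eta>) * norm u)"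
    by (simp add: sum_list_const_mult)
  also have "\<dots> \<le> (\<Sum>u\<leftarrow>us. norm u - 2 * \<eta>)"
  proof (rule sum_list_mono)
    fix u assume "u \<in> set us"
    then have "1 \<le> norm u"
      using us(1) Zn_norm_ge_1 by (auto simp: visible_def)
    then show "(1 - 2 * \<eta>) * norm u \<le> norm u - 2 * \<eta>"
      using \<eta> by (simp add: algebra_simps)
  qed
  finally have le: "(1 - 2 * \<eta>) * (\<Sum>u\<leftarrow>us. norm u) \<le> norm K"
    using us(3) by linarith
  obtain W where W: "\<forall>w\<in>set W. visible m \<eta> w" "distinct_adj W"
    "W \<noteq> [] \<longrightarrow> (\<exists>i. last W = - axis_vec i)"
    "sum_list W = fact L *\<^sub>R K"
    "(\<Sum>w\<leftarrow>W. norm w) \<le> (1 + 2 / L) * (fact L * (\<Sum>u\<leftarrow>us. norm u))"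
    using scaled_visible_sum_as_steps[OF us(1) m L] us(2) \<eta> short by auto
  have "(1 - 2 * \<eta>) * (\<Sum>w\<leftarrow>W. norm w)
      \<le> (1 - 2 * \<eta>) * ((1 + 2 / L) * (fact L * (\<Sum>u\<leftarrow>us. norm u)))"
    by (rule mult_left_mono[OF W(5)]) (use \<eta> in simp)
  also have "\<dots> = (1 + 2 / L) * (fact L * ((1 - 2 * \<eta>) * (\<Sum>u\<leftarrow>us. norm u)))"
    by simp
  also have "\<dots> \<le> (1 + 2 / L) * (fact L * norm K)"
    by (intro mult_left_mono le) auto
  finally have "(1 - 2 * \<eta>) * (\<Sum>w\<leftarrow>W. norm w) \<le> (1 + 2 / L) * (fact L * norm K)" .
  moreover have "- axis_vec i \<noteq> axis_vec 0" for i
    by (metis coord_axis_vec coord_uminus one_neq_neg_one zero_neq_one add.inverse_neutral)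
  then have "W \<noteq> [] \<longrightarrow> last W \<noteq> axis_vec 0"
    using W(3) by metis
  ultimately show ?thesis
    using W(1,2,4) by blast
qed

section \<open>Admissible sequences\<close>

text \<open>For convex \<open>S\<close> the Minkowski sum of \<open>S\<close> and the segment from \<open>i\<close> to \<open>j\<close> is convex and contains both
  obstacles, hence also their convex hull.\<close>

lemma between_imp_near_segment:
  assumes S: "convex S" "bounded S" and "between S k i j"
  shows "\<exists>t\<in>{0..1}. norm (k - i - t *\<^sub>R (j - i)) \<le> diameter S"
proof -
  let ?C = "\<Union>x\<in>S. \<Union>y\<in>closed_segment i j. {x + y}"
  have "convex ?C"
    by (rule convex_sums[OF S(1) convex_closed_segment])
  moreover have "lift S i \<union> lift S j \<subseteq> ?C"
    by (auto simp: lift_def)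
  ultimately have "convex hull (lift S i \<union> lift S j) \<subseteq> ?C"
    by (metis hull_minimal)
  then obtain x x' y where *: "x' \<in> S" "x \<in> S" "y \<in> closed_segment i j" "x' + k = x + y"
    using assms(3) by (fastforce simp: between_def lift_def)
  then obtain t where t: "0 \<le> t" "t \<le> 1" "y = (1 - t) *\<^sub>R i + t *\<^sub>R j"
    by (auto simp: closed_segment_def)
  have k: "k = x + y - x'"
    using *(4) by (simp add: eq_diff_eq add.commute)
  have "k - i - t *\<^sub>R (j - i) = x - x'"
    by (simp add: k t(3) algebra_simps)
  moreover have "norm (x - x') \<le> diameter S"
    using diameter_bounded_bound[OF S(2) *(2,1)] by (simp add: dist_norm)
  ultimately show ?thesis
    using t by (intro bexI[of _ t]) auto
qed

text \<open>If \<open>u\<close> were close to the segment from \<open>0\<close> to \<open>u + w\<close>, then \<open>(1 - t) *\<^sub>R u\<close> would be close to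
  \<open>t *\<^sub>R w\<close>.  Dividing by the larger of \<open>t\<close> and \<open>1 - t\<close>, which loses a factor of at most 2, puts one of
  the two vectors next to the segment from \<open>0\<close> to the other one, against the visibility of the latter.
  So the only visible steps that must not follow each other are equal ones.\<close>

lemma visible_not_near_sum:
  assumes u: "visible m (2 * \<delta>) u" and w: "visible m (2 * \<delta>) w" and "u \<noteq> w" "t \<in> {0..1}"
  shows "\<delta> \<le> norm (u - t *\<^sub>R (u + w))"
proof (cases "t \<le> 1 / 2")
  case True
  define r where "r = t / (1 - t)"
  have r: "r \<in> {0..1}"
    using True assms(4) by (auto simp: r_def field_simps)
  have "(1 - t) * r = t"
    using True by (simp add: r_def)
  then have "(1 - t) *\<^sub>R (u - r *\<^sub>R w) = (1 - t) *\<^sub>R u - t *\<^sub>R w"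
    by (simp add: scaleR_diff_right)
  then have "u - t *\<^sub>R (u + w) = (1 - t) *\<^sub>R (u - r *\<^sub>R w)"
    by (simp add: algebra_simps)
  then have "norm (u - t *\<^sub>R (u + w)) = (1 - t) * norm (u - r *\<^sub>R w)"
    using True by simp
  moreover have "2 * \<delta> \<le> norm (u - r *\<^sub>R w)"
    using w u r assms(3) unfolding visible_def by blast
  moreover have "1 / 2 * norm (u - r *\<^sub>R w) \<le> (1 - t) * norm (u - r *\<^sub>R w)"
    using True by (intro mult_right_mono) auto
  ultimately show ?thesis
    by linarith
next
  case False
  define r where "r = (1 - t) / t"
  have r: "r \<in> {0..1}"
    using False assms(4) by (auto simp: r_def field_simps)
  have "t * r = 1 - t"
    using False by (simp add: r_def)
  then have "t *\<^sub>R (w - r *\<^sub>R u) = t *\<^sub>R w - (1 - t) *\<^sub>R u"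
    by (simp add: scaleR_diff_right)
  then have "u - t *\<^sub>R (u + w) = (- t) *\<^sub>R (w - r *\<^sub>R u)"
    by (simp add: algebra_simps)
  then have "norm (u - t *\<^sub>R (u + w)) = t * norm (w - r *\<^sub>R u)"
    using False by simp
  moreover have "2 * \<delta> \<le> norm (w - r *\<^sub>R u)"
    using w u r assms(3) unfolding visible_def by metis
  moreover have "1 / 2 * norm (w - r *\<^sub>R u) \<le> t * norm (w - r *\<^sub>R u)"
    using False by (intro mult_right_mono) auto
  ultimately show ?thesis
    by linarith
qed

proposition admissible_of_visible_steps:
  assumes S: "convex S" "bounded S" "diameter S < \<delta>"
    and vis: "\<And>n. n < s \<Longrightarrow> visible m (2 * \<delta>) (w n)"
    and dist: "\<And>n. n + 1 < s \<Longrightarrow> w n \<noteq> w (n + 1)"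
  shows "admissible m S s (\<lambda>n. \<Sum>i<n. w i)"
proof -
  have \<delta>: "0 < \<delta>"
    using S diameter_ge_0[OF S(2)] by linarith
  have Zn: "(\<Sum>i<n. w i) \<in> Zn m" if "n \<le> s" for n
    using that
  proof (induction n)
    case (Suc n)
    then show ?case
      using vis[of n] by (auto simp: visible_def)
  qed auto
  show ?thesis
    unfolding admissible_def
  proof (intro conjI allI impI ballI)
    fix n assume "n < s"
    then show "(\<Sum>i<n + 1. w i) \<noteq> (\<Sum>i<n. w i)"
      using vis by (auto simp: visible_def)
  next
    fix n l assume n: "n < s" and l: "l \<in> Zn m"
    show "\<not> between S l (\<Sum>i<n. w i) (\<Sum>i<n + 1. w i)"
    proof
      let ?k = "\<Sum>i<n. w i"
      assume b: "between S l ?k (\<Sum>i<n + 1. w i)"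
      then have ne: "l - ?k \<noteq> 0" "l - ?k \<noteq> w n"
        by (auto simp: between_def diff_eq_eq add.commute)
      obtain t where t: "t \<in> {0..1}" "norm (l - ?k - t *\<^sub>R w n) \<le> diameter S"
        using between_imp_near_segment[OF S(1,2) b] by auto
      moreover have "l - ?k \<in> Zn m"
        using Zn n l by auto
      ultimately have "2 * \<delta> \<le> norm (l - ?k - t *\<^sub>R w n)"
        using vis[OF n] ne unfolding visible_def by blast
      then show False
        using t(2) S(3) \<delta> by linarith
    qed
  next
    fix n assume n: "n + 2 \<le> s"
    show "\<not> between S (\<Sum>i<n + 1. w i) (\<Sum>i<n. w i) (\<Sum>i<n + 2. w i)"
    proof
      assume b: "between S (\<Sum>i<n + 1. w i) (\<Sum>i<n. w i) (\<Sum>i<n + 2. w i)"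
      have "(\<Sum>i<n + 2. w i) - (\<Sum>i<n. w i) = w n + w (n + 1)"
        by (simp add: numeral_2_eq_2)
      then obtain t where t: "t \<in> {0..1}" "norm (w n - t *\<^sub>R (w n + w (n + 1))) \<le> diameter S"
        using between_imp_near_segment[OF S(1,2) b] by auto
      have "visible m (2 * \<delta>) (w n)" "visible m (2 * \<delta>) (w (n + 1))" "w n \<noteq> w (n + 1)"
        using vis dist n by auto
      then have "\<delta> \<le> norm (w n - t *\<^sub>R (w n + w (n + 1)))"
        using t(1) by (rule visible_not_near_sum)
      then show False
        using t(2) S(3) by linarith
    qed
  next
    fix n assume "n \<le> s"
    then show "(\<Sum>i<n. w i) \<in> Zn m"
      by (rule Zn)
  qed simp
qed

section \<open>Relative interior and boundary\<close>

lemma mem_interior_Rn_iff: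
  "x \<in> interior_Rn m S \<longleftrightarrow> x \<in> Rn m \<and> (\<exists>e>0. ball x e \<inter> Rn m \<subseteq> S)"
proof
  assume "x \<in> interior_Rn m S"
  then obtain T where "openin (top_of_set (Rn m)) T" "x \<in> T" "T \<subseteq> S"
    by (auto simp: interior_of_def)
  then show "x \<in> Rn m \<and> (\<exists>e>0. ball x e \<inter> Rn m \<subseteq> S)"
    unfolding openin_contains_ball by (meson order_trans subsetD)
next
  assume "x \<in> Rn m \<and> (\<exists>e>0. ball x e \<inter> Rn m \<subseteq> S)"
  then obtain e where e: "x \<in> Rn m" "0 < e" "ball x e \<inter> Rn m \<subseteq> S"
    by blast
  moreover have "openin (top_of_set (Rn m)) (ball x e \<inter> Rn m)"
    by (metis inf_commute open_ball openin_open_Int)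
  ultimately show "x \<in> interior_Rn m S"
    unfolding interior_of_def by (auto intro!: exI[of _ "ball x e \<inter> Rn m"])
qed

lemma mem_boundary_Rn_iff:
  assumes "x \<in> S" "S \<subseteq> Rn m"
  shows "x \<in> boundary_Rn m S \<longleftrightarrow> x \<notin> interior_Rn m S"
  using assms closure_of_subset[of S "top_of_set (Rn m)"] by (auto simp: frontier_of_def)

lemma boundary_not_interior: "x \<in> boundary_Rn m S \<Longrightarrow> x \<notin> interior_Rn m S"
  by (simp add: frontier_of_def)

lemma mem_lift_iff: "x \<in> lift S k \<longleftrightarrow> x - k \<in> S"
  by (auto simp: lift_def image_iff) (metis diff_add_cancel)

lemma lift_subset_Rn: "S \<subseteq> Rn m \<Longrightarrow> k \<in> Zn m \<Longrightarrow> lift S k \<subseteq> Rn m"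
  using subspace_add[OF subspace_Rn] Zn_subset_Rn by (auto simp: lift_def)

lemma boundary_lift_imp_boundary:
  assumes "S \<subseteq> Rn m" "k \<in> Zn m" "p \<in> lift S k" "p \<in> boundary_Rn m (lift S k)"
  shows "p - k \<in> boundary_Rn m S"
proof -
  have "p - k \<in> S"
    using assms(3) mem_lift_iff by blast
  moreover have "p - k \<notin> interior_Rn m S"
  proof
    assume "p - k \<in> interior_Rn m S"
    then obtain e where e: "0 < e" "ball (p - k) e \<inter> Rn m \<subseteq> S"
      by (auto simp: mem_interior_Rn_iff)
    have "ball p e \<inter> Rn m \<subseteq> lift S k"
    proof
      fix x assume x: "x \<in> ball p e \<inter> Rn m"
      then have "x - k \<in> ball (p - k) e \<inter> Rn m"
        using subspace_diff[OF subspace_Rn] Zn_subset_Rn[OF assms(2)] by (auto simp: dist_norm)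
      then show "x \<in> lift S k"
        using e mem_lift_iff by blast
    qed
    moreover have "p \<in> Rn m"
      using assms lift_subset_Rn by blast
    ultimately have "p \<in> interior_Rn m (lift S k)"
      using e(1) by (auto simp: mem_interior_Rn_iff)
    then show False
      using assms(4) boundary_not_interior by blast
  qed
  ultimately show ?thesis
    using mem_boundary_Rn_iff assms(1) by blast
qed

section \<open>Translations\<close>

text \<open>The smooth structure is given for the obstacle at the origin, but the reflections take place at
  its translates.\<close>

lemma has_gradient_translate:
  assumes "has_gradient m f G x" "c \<in> Rn m"
  shows "has_gradient m (\<lambda>x. f (x - c)) G (x + c)"
proof -
  have "((\<lambda>x. x - c) has_derivative (\<lambda>h. h)) (at (x + c) within Rn m)"
    by (auto intro!: derivative_eq_intros)
  moreover have "(f has_derivative (\<lambda>h. G \<bullet> h)) (at (x + c - c) within (\<lambda>x. x - c) ` Rn m)"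
    by (rule has_derivative_subset[of _ _ _ "Rn m"])
      (use assms subspace_diff[OF subspace_Rn] in \<open>auto simp: has_gradient_def\<close>)
  ultimately show ?thesis
    using has_derivative_in_compose[of "\<lambda>x. x - c" "\<lambda>h. h" "x + c" "Rn m" f "\<lambda>h. G \<bullet> h"] assms(1)
    by (simp add: has_gradient_def)
qed

lemma Ck_on_translate:
  assumes "Ck_on k m U f" "c \<in> Rn m"
  shows "Ck_on k m ((\<lambda>x. x + c) ` U) (\<lambda>x. f (x - c))"
  using assms(1)
proof (induction k arbitrary: f)
  case 0
  have "continuous_on ((\<lambda>x. x + c) ` U) (f \<circ> (\<lambda>x. x - c))"
    by (intro continuous_on_compose continuous_intros)
      (use 0 in \<open>simp add: image_image\<close>)
  then show ?case
    by (simp add: o_def)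
next
  case (Suc k)
  then obtain G where G: "\<forall>x\<in>U. has_gradient m f (G x) x" "\<forall>i<m. Ck_on k m U (\<lambda>x. coord (G x) i)"
    by auto
  then have "\<forall>i<m. Ck_on k m ((\<lambda>x. x + c) ` U) (\<lambda>x. coord (G (x - c)) i)"
    using Suc.IH by blast
  moreover have "\<forall>x\<in>(\<lambda>x. x + c) ` U. has_gradient m (\<lambda>x. f (x - c)) (G (x - c)) x"
    using G(1) has_gradient_translate[OF _ assms(2)] by auto
  ultimately show ?case
    unfolding Ck_on.simps by (intro exI[of _ "\<lambda>x. G (x - c)"] conjI)
qed

lemma local_defining_function_translate:
  assumes "local_defining_function m S p U f G" "c \<in> Rn m"
  shows "local_defining_function m ((\<lambda>x. x + c) ` S) (p + c) ((\<lambda>x. x + c) ` U) (\<lambda>x. f (x - c)) G"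
  unfolding local_defining_function_def
proof (intro conjI allI)
  show "p + c \<in> (\<lambda>x. x + c) ` U" "G \<noteq> 0"
    using assms(1) by (auto simp: local_defining_function_def)
  show "Ck_on k m ((\<lambda>x. x + c) ` U) (\<lambda>x. f (x - c))" for k
    using assms Ck_on_translate by (simp add: local_defining_function_def)
  show "has_gradient m (\<lambda>x. f (x - c)) G (p + c)"
    using assms has_gradient_translate by (simp add: local_defining_function_def)
  have U: "openin (top_of_set (Rn m)) U"
    using assms(1) by (simp add: local_defining_function_def)
  show "openin (top_of_set (Rn m)) ((\<lambda>x. x + c) ` U)"
    unfolding openin_contains_ball
  proof (intro conjI ballI)
    show "(\<lambda>x. x + c) ` U \<subseteq> Rn m"
      using U subspace_add[OF subspace_Rn] assms(2) by (auto simp: openin_contains_ball)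
    fix y assume "y \<in> (\<lambda>x. x + c) ` U"
    then obtain x where x: "x \<in> U" "y = x + c"
      by blast
    then obtain e where e: "0 < e" "ball x e \<inter> Rn m \<subseteq> U"
      using U by (meson openin_contains_ball)
    have "ball y e \<inter> Rn m \<subseteq> (\<lambda>x. x + c) ` U"
    proof
      fix z assume z: "z \<in> ball y e \<inter> Rn m"
      then have "z - c \<in> ball x e \<inter> Rn m"
        using subspace_diff[OF subspace_Rn] assms(2) x by (auto simp: dist_norm algebra_simps)
      then show "z \<in> (\<lambda>x. x + c) ` U"
        using e by (metis diff_add_cancel imageI subsetD)
    qed
    then show "\<exists>e. 0 < e \<and> ball y e \<inter> Rn m \<subseteq> (\<lambda>x. x + c) ` U"
      using e by blast
  qed
  show "(\<lambda>x. x + c) ` S \<inter> (\<lambda>x. x + c) ` U = {x \<in> (\<lambda>x. x + c) ` U. f (x - c) \<le> 0}"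
  proof -
    have "S \<inter> U = {x \<in> U. f x \<le> 0}"
      using assms(1) by (simp add: local_defining_function_def)
    moreover have "(\<lambda>x. x + c) ` S \<inter> (\<lambda>x. x + c) ` U = (\<lambda>x. x + c) ` (S \<inter> U)"
      by (rule image_Int[symmetric]) simp
    ultimately show ?thesis
      by auto
  qed
qed

section \<open>The reflection law at a local minimum\<close>

text \<open>The gradient at \<open>p\<close> of the sum of the distances to \<open>a\<close> and \<open>b\<close> is \<open>D = u - v\<close>.  It is nonnegative
  on every direction that points into the obstacle, that is, on the open half space where the
  gradient \<open>G\<close> of the defining function is negative; therefore \<open>D\<close> is a multiple of \<open>G\<close>.  As \<open>u\<close> and \<open>v\<close> are
  unit vectors, this leaves the reflection law and the case \<open>u = v\<close>, in which \<open>p\<close> would lie between \<open>a\<close>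
  and \<open>b\<close>.\<close>

lemma reflects_of_shortest:
  assumes p: "p \<in> boundary_Rn m S" and ldf: "local_defining_function m S p U f G"
    and Rn: "a \<in> Rn m" "b \<in> Rn m" and pS: "p \<in> S" and "a \<noteq> p" "b \<noteq> p" "p \<notin> closed_segment a b"
    and short: "\<And>q. q \<in> S \<Longrightarrow> dist a p + dist p b \<le> dist a q + dist q b"
  shows "reflects m S a p b"
proof -
  have U: "openin (top_of_set (Rn m)) U" "p \<in> U" "S \<inter> U = {x \<in> U. f x \<le> 0}"
    and G: "G \<in> Rn m" "(f has_derivative (\<lambda>h. G \<bullet> h)) (at p within Rn m)" "G \<noteq> 0"
    using ldf by (auto simp: local_defining_function_def has_gradient_def)
  have pRn: "p \<in> Rn m"
    using U by (auto simp: openin_contains_ball)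
  define u where "u = (p - a) /\<^sub>R norm (p - a)"
  define v where "v = (b - p) /\<^sub>R norm (b - p)"
  have nu: "norm u = 1" and nv: "norm v = 1"
    using assms by (auto simp: u_def v_def)
  define D where "D = u - v"
  have D: "D \<in> Rn m"
    unfolding D_def u_def v_def using Rn pRn
    by (intro subspace_diff[OF subspace_Rn] subspace_scale[OF subspace_Rn])
  have first_order: "0 \<le> D \<bullet> h" if h: "h \<in> Rn m" "G \<bullet> h < 0" for h
  proof (rule ccontr)
    assume neg: "\<not> 0 \<le> D \<bullet> h"
    define g where "g t = dist a (p + t *\<^sub>R h) + dist (p + t *\<^sub>R h) b" for t
    have "((\<lambda>t. norm (p + t *\<^sub>R h - c)) has_derivative (\<lambda>t. sgn (p - c) \<bullet> (t *\<^sub>R h))) (at 0)"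
      if "c \<noteq> p" for c
    proof -
      have "((\<lambda>t. p + t *\<^sub>R h - c) has_derivative (\<lambda>t. t *\<^sub>R h)) (at 0)"
        by (auto intro!: derivative_eq_intros)
      then show ?thesis
        using has_derivative_compose[of "\<lambda>t. p + t *\<^sub>R h - c" "\<lambda>t. t *\<^sub>R h" 0 UNIV norm "\<lambda>h. sgn (p - c) \<bullet> h"]
          has_derivative_norm[of "p - c"] that by (simp add: inner_commute)
    qed
    from has_derivative_add[OF this[of a] this[of b]]
    have "(g has_derivative (\<lambda>t. sgn (p - a) \<bullet> (t *\<^sub>R h) + sgn (p - b) \<bullet> (t *\<^sub>R h))) (at 0)"
      using assms unfolding g_def by (simp add: dist_norm norm_minus_commute)
    moreover have "sgn (p - a) = u" "sgn (p - b) = - v"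
      by (simp_all add: u_def v_def sgn_div_norm norm_minus_commute flip: scaleR_minus_right)
    moreover have "(\<lambda>t. u \<bullet> (t *\<^sub>R h) + - v \<bullet> (t *\<^sub>R h)) = (*) (D \<bullet> h)"
      by (rule ext) (simp add: D_def algebra_simps)
    ultimately have "(g has_real_derivative D \<bullet> h) (at 0)"
      by (simp only: has_field_derivative_def)
    then obtain d1 where d1: "0 < d1" "\<And>t. 0 < t \<Longrightarrow> t < d1 \<Longrightarrow> g t < g 0"
      using has_real_derivative_neg_dec_right[of g "D \<bullet> h" 0 UNIV] neg by auto
    have line: "p + t *\<^sub>R h \<in> Rn m" for t
      using subspace_add[OF subspace_Rn] subspace_scale[OF subspace_Rn] pRn h by blast
    have "((\<lambda>t. p + t *\<^sub>R h) has_derivative (\<lambda>t. t *\<^sub>R h)) (at 0)"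
      by (auto intro!: derivative_eq_intros)
    moreover have "(f has_derivative (\<lambda>h. G \<bullet> h)) (at (p + 0 *\<^sub>R h) within range (\<lambda>t. p + t *\<^sub>R h))"
      by (rule has_derivative_subset[of _ _ _ "Rn m"]) (use G line in auto)
    ultimately have "((\<lambda>t. f (p + t *\<^sub>R h)) has_derivative (\<lambda>t. G \<bullet> (t *\<^sub>R h))) (at 0)"
      using has_derivative_in_compose[of "\<lambda>t. p + t *\<^sub>R h" "\<lambda>t. t *\<^sub>R h" 0 UNIV] by blast
    moreover have "(\<lambda>t. G \<bullet> (t *\<^sub>R h)) = (*) (G \<bullet> h)"
      by (rule ext) simp
    ultimately have "((\<lambda>t. f (p + t *\<^sub>R h)) has_real_derivative G \<bullet> h) (at 0)"
      by (simp only: has_field_derivative_def)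
    then obtain d2 where d2: "0 < d2" "\<And>t. 0 < t \<Longrightarrow> t < d2 \<Longrightarrow> f (p + t *\<^sub>R h) < f p"
      using has_real_derivative_neg_dec_right[of "\<lambda>t. f (p + t *\<^sub>R h)" "G \<bullet> h" 0 UNIV] h by auto
    obtain e where e: "0 < e" "ball p e \<inter> Rn m \<subseteq> U"
      using U by (meson openin_contains_ball)
    have h0: "0 < norm h"
      using h by auto
    define r where "r = e / norm h"
    have r: "0 < r"
      using e h0 by (simp add: r_def)
    define t where "t = min (min d1 d2) r / 2"
    have t: "0 < t" "t < d1" "t < d2" "t < r"
      using d1(1) d2(1) r by (auto simp: t_def min_def)
    then have "t * norm h < e"
      using h0 by (simp add: r_def pos_less_divide_eq)
    then have "p + t *\<^sub>R h \<in> U"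
      using e line t by (auto simp: dist_norm subset_iff)
    moreover have "f p \<le> 0"
      using U pS by blast
    ultimately have "p + t *\<^sub>R h \<in> {x \<in> U. f x \<le> 0}"
      using d2(2)[OF t(1,3)] by simp
    then have "p + t *\<^sub>R h \<in> S"
      using U(3) by blast
    then show False
      using short[of "p + t *\<^sub>R h"] d1(2)[OF t(1,2)] by (simp add: g_def)
  qed
  define c where "c = D \<bullet> G / (G \<bullet> G)"
  define E where "E = D - c *\<^sub>R G"
  have GG: "0 < G \<bullet> G"
    using G by simp
  have EG: "G \<bullet> E = 0"
    using GG by (simp add: E_def c_def algebra_simps inner_commute)
  have DE: "D = E + c *\<^sub>R G"
    by (simp add: E_def)
  have E_Rn: "E \<in> Rn m"
    unfolding E_def using D G by (intro subspace_diff[OF subspace_Rn] subspace_scale[OF subspace_Rn])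
  \<comment> \<open>The direction \<open>- E\<close> is tangent to the obstacle; the small multiple \<open>- r *\<^sub>R G\<close> makes it point inwards.\<close>
  have "E \<bullet> E \<le> 0"
  proof (rule field_le_epsilon)
    fix \<epsilon> :: real assume \<epsilon>: "0 < \<epsilon>"
    define r where "r = \<epsilon> / ((\<bar>c\<bar> + 1) * (G \<bullet> G))"
    have pos: "0 < (\<bar>c\<bar> + 1) * (G \<bullet> G)"
      using GG by (intro mult_pos_pos) auto
    have r0: "0 < r"
      unfolding r_def by (rule divide_pos_pos[OF \<epsilon> pos])
    have "r * (\<bar>c\<bar> * (G \<bullet> G)) \<le> r * ((\<bar>c\<bar> + 1) * (G \<bullet> G))"
      using r0 GG by (intro mult_left_mono mult_right_mono) auto
    also have "\<dots> = \<epsilon>"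
      using pos unfolding r_def by (metis less_irrefl nonzero_eq_divide_eq)
    finally have r: "0 < r" "r * (\<bar>c\<bar> * (G \<bullet> G)) \<le> \<epsilon>"
      using r0 by auto
    have "0 \<le> D \<bullet> (- (r *\<^sub>R G) - E)"
    proof (rule first_order)
      show "- (r *\<^sub>R G) - E \<in> Rn m"
        using E_Rn G by (intro subspace_diff[OF subspace_Rn] subspace_neg[OF subspace_Rn] subspace_scale[OF subspace_Rn])
      show "G \<bullet> (- (r *\<^sub>R G) - E) < 0"
        using r GG EG by (simp add: inner_diff_right)
    qed
    also have "D \<bullet> (- (r *\<^sub>R G) - E) = - (r * (c * (G \<bullet> G))) - E \<bullet> E"
      using EG by (simp add: DE inner_diff_right inner_add_left inner_add_right inner_commute)
    finally have "E \<bullet> E \<le> - (r * (c * (G \<bullet> G)))"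
      by simp
    also have "\<dots> = r * ((- c) * (G \<bullet> G))"
      by simp
    also have "\<dots> \<le> r * (\<bar>c\<bar> * (G \<bullet> G))"
      by (intro mult_left_mono mult_right_mono) (use r GG in auto)
    finally show "E \<bullet> E \<le> 0 + \<epsilon>"
      using r by linarith
  qed
  then have "E = 0"
    by (metis inner_gt_zero_iff linorder_not_le)
  define \<nu> where "\<nu> = G /\<^sub>R norm G"
  define c' where "c' = c * norm G"
  have uv: "v = u - c' *\<^sub>R \<nu>"
    using DE \<open>E = 0\<close> G(3) by (simp add: D_def c'_def \<nu>_def algebra_simps)
  have n\<nu>: "\<nu> \<bullet> \<nu> = 1"
    using G(3) by (simp add: \<nu>_def dot_square_norm power2_eq_square)
  have "1 = v \<bullet> v"
    using nv by (simp add: dot_square_norm)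
  also have "\<dots> = u \<bullet> u - 2 * c' * (u \<bullet> \<nu>) + c' * c'"
    unfolding uv using n\<nu> by (simp add: inner_diff_left inner_diff_right inner_commute algebra_simps)
  also have "u \<bullet> u = 1"
    using nu by (simp add: dot_square_norm)
  finally have "c' * c' = c' * (2 * (u \<bullet> \<nu>))"
    by simp
  then have "c' = 0 \<or> c' = 2 * (u \<bullet> \<nu>)"
    by (metis mult_cancel_left)
  moreover have "c' \<noteq> 0"
  proof
    assume "c' = 0"
    then have "u = v"
      using uv by simp
    define \<alpha> where "\<alpha> = norm (p - a)"
    define \<beta> where "\<beta> = norm (b - p)"
    have pos: "0 < \<alpha>" "0 < \<beta>"
      using assms by (auto simp: \<alpha>_def \<beta>_def)
    have "p - a = \<alpha> *\<^sub>R u"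
      using pos(1) by (simp add: u_def \<alpha>_def)
    moreover have "b - p = \<beta> *\<^sub>R u"
      unfolding \<open>u = v\<close> using pos(2) by (simp add: v_def \<beta>_def)
    ultimately have "a = p - \<alpha> *\<^sub>R u" "b = p + \<beta> *\<^sub>R u"
      by (simp_all add: algebra_simps)
    then have ab: "p = a + \<alpha> *\<^sub>R u" "b = a + (\<alpha> + \<beta>) *\<^sub>R u"
      by (simp_all add: algebra_simps)
    have "p = a + (\<alpha> / (\<alpha> + \<beta>)) *\<^sub>R (b - a)"
      using pos by (subst ab(1), subst ab(2)) simp
    then have "p = (1 - \<alpha> / (\<alpha> + \<beta>)) *\<^sub>R a + (\<alpha> / (\<alpha> + \<beta>)) *\<^sub>R b"
      by (simp add: algebra_simps)
    moreover have "0 \<le> \<alpha> / (\<alpha> + \<beta>)" "\<alpha> / (\<alpha> + \<beta>) \<le> 1"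
      using pos by auto
    ultimately have "p \<in> closed_segment a b"
      unfolding closed_segment_def by blast
    then show False
      using assms by blast
  qed
  ultimately have "c' = 2 * (u \<bullet> \<nu>)"
    by simp
  then have "u \<bullet> \<nu> \<noteq> 0" "v = u - (2 * (u \<bullet> \<nu>)) *\<^sub>R \<nu>"
    using uv \<open>c' \<noteq> 0\<close> by auto
  moreover have "outward_unit_normal m S p \<nu>"
    unfolding outward_unit_normal_def using p ldf \<nu>_def by blast
  ultimately show ?thesis
    unfolding reflects_def u_def[symmetric] v_def[symmetric] Let_def by blast
qed

section \<open>Shortest chains through the obstacles\<close>

definition path_length :: "nat \<Rightarrow> (nat \<Rightarrow> fseq) \<Rightarrow> real" where
  "path_length s p = (\<Sum>n<s. dist (p n) (p (n + 1)))"

definition chain :: "fseq set \<Rightarrow> (nat \<Rightarrow> fseq) \<Rightarrow> nat \<Rightarrow> (nat \<Rightarrow> fseq) \<Rightarrow> bool" where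
  "chain S k s p \<longleftrightarrow> (\<forall>n\<le>s. p n \<in> lift S (k n))"

definition shortest_chain :: "fseq set \<Rightarrow> (nat \<Rightarrow> fseq) \<Rightarrow> nat \<Rightarrow> (nat \<Rightarrow> fseq) \<Rightarrow> bool" where
  "shortest_chain S k s p \<longleftrightarrow>
     chain S k s p \<and> (\<forall>q. chain S k s q \<longrightarrow> path_length s p \<le> path_length s q)"

lemma path_length_cong: "(\<And>n. n \<le> s \<Longrightarrow> p n = q n) \<Longrightarrow> path_length s p = path_length s q"
  unfolding path_length_def by (intro sum.cong) auto

lemma dist_le_path_length: "dist (p 0) (p s) \<le> path_length s p"
proof (induction s)
  case (Suc s)
  then show ?case
    using dist_triangle[of "p 0" "p (Suc s)" "p s"] by (simp add: path_length_def)
qed (simp add: path_length_def)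

text \<open>Points with index above \<open>s\<close> do not matter for the length; letting them range over their obstacles
  as well gives a product of compact sets over all indices, which is compact by Tychonoff's theorem.\<close>

lemma shortest_chain_exists:
  assumes "compact S" "S \<noteq> {}"
  shows "\<exists>p. shortest_chain S k s p"
proof -
  define T where "T = PiE UNIV (\<lambda>n. lift S (k n))"
  obtain x where x: "x \<in> S"
    using assms(2) by blast
  have lift_k: "x + k n \<in> lift S (k n)" for n
    using x by (simp add: lift_def)
  have comp: "compact (lift S (k n))" for n
    unfolding lift_def by (intro compact_continuous_image continuous_intros assms(1))
  have "compactin (product_topology (\<lambda>_. euclidean) UNIV) T"
    unfolding T_def compactin_PiE using comp by auto
  then have "compact T"
    by (simp add: euclidean_product_topology)
  moreover have "T \<noteq> {}"
    using lift_k unfolding T_def by (auto simp: PiE_eq_empty_iff lift_def x) (use assms(2) in blast)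
  moreover have "continuous_on T (path_length s)"
    unfolding path_length_def
    by (intro continuous_intros continuous_on_product_then_coordinatewise)
  ultimately obtain p where p: "p \<in> T" "\<And>q. q \<in> T \<Longrightarrow> path_length s p \<le> path_length s q"
    by (metis continuous_attains_inf)
  have "path_length s p \<le> path_length s q" if "chain S k s q" for q
  proof -
    let ?q = "\<lambda>n. if n \<le> s then q n else x + k n"
    have "?q \<in> T"
      using that lift_k by (auto simp: T_def chain_def)
    then show ?thesis
      using p(2)[of ?q] path_length_cong[of s ?q q] by simp
  qed
  then show ?thesis
    using p(1) by (intro exI[of _ p]) (auto simp: shortest_chain_def chain_def T_def)
qed

lemma path_length_move_point:
  assumes "0 < n" "n < s"
  shows "path_length s (p(n := q)) + (dist (p (n - 1)) (p n) + dist (p n) (p (n + 1))) =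
         path_length s p + (dist (p (n - 1)) q + dist q (p (n + 1)))"
proof -
  have split: "path_length s p = dist (p (n - 1)) (p n) + dist (p n) (p (n + 1)) +
       (\<Sum>i\<in>{..<s} - {n - 1, n}. dist (p i) (p (i + 1)))" for p :: "nat \<Rightarrow> fseq"
  proof -
    have "path_length s p = (\<Sum>i\<in>{n - 1, n}. dist (p i) (p (i + 1))) +
        (\<Sum>i\<in>{..<s} - {n - 1, n}. dist (p i) (p (i + 1)))"
      unfolding path_length_def by (subst sum.subset_diff[of "{n - 1, n}"]) (use assms in auto)
    then show ?thesis
      using assms by simp
  qed
  have "(\<Sum>i\<in>{..<s} - {n - 1, n}. dist ((p(n := q)) i) ((p(n := q)) (i + 1))) =
      (\<Sum>i\<in>{..<s} - {n - 1, n}. dist (p i) (p (i + 1)))"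
    by (intro sum.cong) (use assms in auto)
  then show ?thesis
    using split[of p] split[of "p(n := q)"] assms by auto
qed

lemma shortest_chain_local:
  assumes p: "shortest_chain S k s p" and q: "q \<in> lift S (k n)"
  shows "0 < n \<Longrightarrow> n < s \<Longrightarrow>
      dist (p (n - 1)) (p n) + dist (p n) (p (n + 1)) \<le> dist (p (n - 1)) q + dist q (p (n + 1))"
    and "n = 0 \<Longrightarrow> 0 < s \<Longrightarrow> dist (p 0) (p 1) \<le> dist q (p 1)"
    and "n = s \<Longrightarrow> 0 < s \<Longrightarrow> dist (p (s - 1)) (p s) \<le> dist (p (s - 1)) q"
proof -
  have "chain S k s (p(n := q))"
    using p q by (auto simp: shortest_chain_def chain_def)
  then have le: "path_length s p \<le> path_length s (p(n := q))"
    using p by (simp add: shortest_chain_def)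
  show "dist (p (n - 1)) (p n) + dist (p n) (p (n + 1)) \<le> dist (p (n - 1)) q + dist q (p (n + 1))"
    if "0 < n" "n < s"
    using le path_length_move_point[OF that, of p q] by linarith
  show "dist (p 0) (p 1) \<le> dist q (p 1)" if "n = 0" "0 < s"
  proof -
    have "path_length s r = dist (r 0) (r 1) + (\<Sum>i\<in>{..<s} - {0}. dist (r i) (r (i + 1)))" for r
      unfolding path_length_def using that by (subst sum.remove[of _ 0]) auto
    moreover have "(\<Sum>i\<in>{..<s} - {0}. dist ((p(n := q)) i) ((p(n := q)) (i + 1))) =
        (\<Sum>i\<in>{..<s} - {0}. dist (p i) (p (i + 1)))"
      by (intro sum.cong) (use that in auto)
    ultimately show ?thesis
      using le that by simp
  qed
  show "dist (p (s - 1)) (p s) \<le> dist (p (s - 1)) q" if "n = s" "0 < s"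
  proof -
    have "path_length s r = dist (r (s - 1)) (r s) + (\<Sum>i\<in>{..<s} - {s - 1}. dist (r i) (r (i + 1)))" for r
      unfolding path_length_def using that by (subst sum.remove[of _ "s - 1"]) auto
    moreover have "(\<Sum>i\<in>{..<s} - {s - 1}. dist ((p(n := q)) i) ((p(n := q)) (i + 1))) =
        (\<Sum>i\<in>{..<s} - {s - 1}. dist (p i) (p (i + 1)))"
      by (intro sum.cong) (use that in auto)
    moreover have "s - 1 \<noteq> s"
      using that by simp
    ultimately show ?thesis
      using le that by simp
  qed
qed

lemma dist_split_closed_segment:
  fixes x y q :: "'a::real_normed_vector"
  assumes "q \<in> closed_segment x y"
  shows "dist x y = dist x q + dist q y"
proof -
  obtain t where t: "0 \<le> t" "t \<le> 1" "q = (1 - t) *\<^sub>R x + t *\<^sub>R y"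
    using assms by (auto simp: closed_segment_def)
  have "x - q = t *\<^sub>R (x - y)" "q - y = (1 - t) *\<^sub>R (x - y)"
    by (simp_all add: t(3) algebra_simps)
  then have "dist x q = t * dist x y" "dist q y = (1 - t) * dist x y"
    using t(1,2) by (simp_all add: dist_norm)
  then show ?thesis
    by (simp add: algebra_simps)
qed

text \<open>Used for a shortest chain \<open>\<dots>, a, p, b, \<dots>\<close>: if the segment from \<open>p\<close> to \<open>b\<close> had another point \<open>q\<close> in the
  obstacle of \<open>p\<close>, then going from \<open>a\<close> to \<open>b\<close> via \<open>q\<close> could only be as long as via \<open>p\<close> if \<open>a\<close>, \<open>p\<close>, \<open>q\<close>,
  \<open>b\<close> are in this order on a line.\<close>

lemma shortcut_imp_collinear:
  fixes a b p q :: "'a::real_inner"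
  assumes q: "q \<in> closed_segment p b" "q \<noteq> p"
    and le: "dist a p + dist p b \<le> dist a q + dist q b"
  shows "p \<in> closed_segment a b"
proof -
  obtain t where t: "0 \<le> t" "t \<le> 1" "q = (1 - t) *\<^sub>R p + t *\<^sub>R b"
    using q(1) by (auto simp: closed_segment_def)
  define d where "d = b - p"
  have qd: "q = p + t *\<^sub>R d"
    by (simp add: t(3) d_def algebra_simps)
  have t0: "0 < t" and d0: "d \<noteq> 0"
    using q(2) qd t(1) by (auto simp: less_le)
  have "dist a p + dist p q \<le> dist a q"
    using le dist_split_closed_segment[OF q(1)] by linarith
  then have "dist a q = dist a p + dist p q"
    using dist_triangle[of a q p] by linarith
  then have "norm (p - a) *\<^sub>R (q - p) = norm (q - p) *\<^sub>R (p - a)"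
    using norm_triangle_eq[of "p - a" "q - p"] by (simp add: dist_norm norm_minus_commute)
  then have "norm (p - a) *\<^sub>R t *\<^sub>R d = (t * norm d) *\<^sub>R (p - a)"
    using qd t0 by simp
  then have scaled: "t *\<^sub>R (norm (p - a) *\<^sub>R d) = t *\<^sub>R (norm d *\<^sub>R (p - a))"
    by (simp add: mult.commute)
  have "t \<noteq> 0"
    using t0 by simp
  from scaleR_left_imp_eq[OF this scaled]
  have col: "norm (p - a) *\<^sub>R d = norm d *\<^sub>R (p - a)" .
  define \<alpha> where "\<alpha> = norm (p - a)"
  define \<beta> where "\<beta> = norm d"
  have pos: "0 \<le> \<alpha>" "0 < \<beta>"
    using d0 by (auto simp: \<alpha>_def \<beta>_def)
  have "(\<alpha> + \<beta>) *\<^sub>R (p - a) = \<alpha> *\<^sub>R (b - a)"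
    using col by (simp add: d_def \<alpha>_def \<beta>_def algebra_simps)
  then have "p - a = (\<alpha> / (\<alpha> + \<beta>)) *\<^sub>R (b - a)"
    using pos by (simp add: eq_vector_fraction_iff)
  then have "p = (1 - \<alpha> / (\<alpha> + \<beta>)) *\<^sub>R a + (\<alpha> / (\<alpha> + \<beta>)) *\<^sub>R b"
    by (simp add: algebra_simps)
  moreover have "0 \<le> \<alpha> / (\<alpha> + \<beta>)" "\<alpha> / (\<alpha> + \<beta>) \<le> 1"
    using pos by auto
  ultimately show ?thesis
    unfolding closed_segment_def by blast
qed

lemma closed_segment_subset_hull_lift:
  "x \<in> lift S i \<Longrightarrow> y \<in> lift S j \<Longrightarrow>
     closed_segment x y \<subseteq> convex hull (lift S i \<union> lift S j)"
  by (rule closed_segment_subset_convex_hull) (auto intro: hull_inc)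

text \<open>Near an interior point all the points of a segment starting there would belong to the set.\<close>

lemma not_interior_if_isolated_on_segment:
  assumes "T \<subseteq> Rn m" "y \<in> Rn m" "x \<noteq> y" "closed_segment x y \<inter> T \<subseteq> {x}"
  shows "x \<notin> interior_Rn m T"
proof
  assume "x \<in> interior_Rn m T"
  then obtain e where e: "x \<in> Rn m" "0 < e" "ball x e \<inter> Rn m \<subseteq> T"
    by (auto simp: mem_interior_Rn_iff)
  define t where "t = min 1 (e / norm (y - x) / 2)"
  have d: "0 < norm (y - x)"
    using assms(3) by simp
  have t: "0 < t" "t \<le> 1"
    using e(2) d by (auto simp: t_def)
  have "t * norm (y - x) \<le> e / norm (y - x) / 2 * norm (y - x)"
    by (rule mult_right_mono) (use d in \<open>auto simp: t_def\<close>)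
  also have "\<dots> < e"
    using d e(2) by simp
  finally have small: "t * norm (y - x) < e" .
  define z where "z = x + t *\<^sub>R (y - x)"
  have "z \<in> Rn m"
    unfolding z_def using e(1) assms(2)
    by (intro subspace_add[OF subspace_Rn] subspace_scale[OF subspace_Rn] subspace_diff[OF subspace_Rn])
  moreover have "dist x z < e"
    using small t by (simp add: z_def dist_norm)
  ultimately have "z \<in> T"
    using e(3) by auto
  moreover have "z \<in> closed_segment x y"
    unfolding closed_segment_def using t
    by (auto simp: z_def algebra_simps intro!: exI[of _ t])
  moreover have "z \<noteq> x"
    using t assms(3) by (simp add: z_def)
  ultimately show False
    using assms(4) by blast
qed

context
  fixes m S s k p
  assumes ob: "obstacle m S" and adm: "admissible m S s k" and p: "shortest_chain S k s p"
begin

lemma chain_points: "n \<le> s \<Longrightarrow> p n \<in> lift S (k n)"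
  using p by (simp add: shortest_chain_def chain_def)

lemma k_in_Zn: "n \<le> s \<Longrightarrow> k n \<in> Zn m"
  using adm by (simp add: admissible_def)

text \<open>This is where the last condition of admissibility enters.\<close>

lemma chain_turns:
  assumes "0 < n" "n < s"
  shows "p n \<notin> closed_segment (p (n - 1)) (p (n + 1))"
proof
  assume *: "p n \<in> closed_segment (p (n - 1)) (p (n + 1))"
  obtain j where j: "n = j + 1"
    using assms(1) by (metis Suc_eq_plus1 Suc_pred')
  have "k (j + 1) \<noteq> k j" "k (j + 1 + 1) \<noteq> k (j + 1)" "\<not> between S (k (j + 1)) (k j) (k (j + 2))"
    using adm assms(2) unfolding j admissible_def by auto
  then have "k n \<noteq> k (n - 1)" "k n \<noteq> k (n + 1)" "\<not> between S (k n) (k (n - 1)) (k (n + 1))"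
    unfolding j by (auto simp: eq_commute)
  moreover have "p n \<in> convex hull (lift S (k (n - 1)) \<union> lift S (k (n + 1)))"
    using * closed_segment_subset_hull_lift chain_points[of "n - 1"] chain_points[of "n + 1"] assms
    by fastforce
  moreover have "p n \<in> lift S (k n)"
    using chain_points assms by simp
  ultimately show False
    unfolding between_def by blast
qed

lemma segment_leaves_first_obstacle:
  assumes "n < s" "q \<in> closed_segment (p n) (p (n + 1))" "q \<in> lift S (k n)"
  shows "q = p n"
proof (rule ccontr)
  assume "q \<noteq> p n"
  show False
  proof (cases "n = 0")
    case True
    then have "dist (p 0) (p 1) \<le> dist q (p 1)"
      using shortest_chain_local(2)[OF p assms(3)] assms(1) by simp
    then have "dist (p n) q \<le> 0"
      using dist_split_closed_segment[OF assms(2)] True by simp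
    then show False
      using \<open>q \<noteq> p n\<close> by simp
  next
    case False
    then show False
      using shortest_chain_local(1)[OF p assms(3)] assms chain_turns[of n]
        shortcut_imp_collinear[OF assms(2) \<open>q \<noteq> p n\<close>] by auto
  qed
qed

lemma segment_meets_last_obstacle_at_end:
  assumes "n < s" "q \<in> closed_segment (p n) (p (n + 1))" "q \<in> lift S (k (n + 1))"
  shows "q = p (n + 1)"
proof (rule ccontr)
  assume "q \<noteq> p (n + 1)"
  have q: "q \<in> closed_segment (p (n + 1)) (p n)"
    using assms(2) by (simp add: closed_segment_commute)
  show False
  proof (cases "n + 1 = s")
    case True
    then have "dist (p (s - 1)) (p s) \<le> dist (p (s - 1)) q"
      using shortest_chain_local(3)[OF p assms(3)] assms(1) by simp
    moreover have "n = s - 1"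
      using True by simp
    ultimately have "dist q (p (n + 1)) \<le> 0"
      using dist_split_closed_segment[OF assms(2)] True by simp
    then show False
      using \<open>q \<noteq> p (n + 1)\<close> by simp
  next
    case False
    then have n: "0 < n + 1" "n + 1 < s"
      using assms(1) by auto
    have "dist (p n) (p (n + 1)) + dist (p (n + 1)) (p (n + 2)) \<le> dist (p n) q + dist q (p (n + 2))"
      using shortest_chain_local(1)[OF p assms(3) n] by simp
    then have "p (n + 1) \<in> closed_segment (p (n + 2)) (p n)"
      by (intro shortcut_imp_collinear[OF q \<open>q \<noteq> p (n + 1)\<close>]) (simp add: dist_commute add.commute)
    then show False
      using chain_turns[OF n] by (simp add: closed_segment_commute)
  qed
qed

lemma chain_points_distinct: "n < s \<Longrightarrow> p n \<noteq> p (n + 1)"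
proof
  assume n: "n < s" "p n = p (n + 1)"
  have "lift S (k n) \<inter> lift S (k (n + 1)) = {}"
  proof -
    have "\<forall>i\<in>Zn m. \<forall>j\<in>Zn m. i \<noteq> j \<longrightarrow> lift S i \<inter> lift S j = {}"
      using ob by (simp add: obstacle_def)
    moreover have "k n \<in> Zn m" "k (n + 1) \<in> Zn m"
      using k_in_Zn[of n] k_in_Zn[of "n + 1"] n(1) by simp_all
    moreover have "k (n + 1) \<noteq> k n"
      using adm n(1) by (simp add: admissible_def)
    ultimately show ?thesis
      by metis
  qed
  then show False
    using chain_points[of n] chain_points[of "n + 1"] n by auto
qed

lemma lift_k_subset_Rn: "n \<le> s \<Longrightarrow> lift S (k n) \<subseteq> Rn m"
  using ob lift_subset_Rn k_in_Zn by (simp add: obstacle_def)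

lemma chain_points_in_boundary:
  assumes "n \<le> s" "0 < s"
  shows "p n \<in> boundary_Rn m (lift S (k n))"
proof -
  have "p n \<notin> interior_Rn m (lift S (k n))"
  proof (cases "n < s")
    case True
    show ?thesis
    proof (rule not_interior_if_isolated_on_segment)
      show "closed_segment (p n) (p (n + 1)) \<inter> lift S (k n) \<subseteq> {p n}"
        using segment_leaves_first_obstacle True by blast
      show "p (n + 1) \<in> Rn m"
        using chain_points[of "n + 1"] lift_k_subset_Rn[of "n + 1"] True by auto
    qed (use lift_k_subset_Rn assms chain_points_distinct True in auto)
  next
    case False
    then have n: "n = s" "n - 1 < s" "n - 1 + 1 = n"
      using assms by auto
    show ?thesis
    proof (rule not_interior_if_isolated_on_segment)
      show "closed_segment (p n) (p (n - 1)) \<inter> lift S (k n) \<subseteq> {p n}"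
        using segment_meets_last_obstacle_at_end[OF n(2)] n(3) by (auto simp: closed_segment_commute)
      show "p (n - 1) \<in> Rn m"
        using chain_points[of "n - 1"] lift_k_subset_Rn[of "n - 1"] n by auto
      show "p n \<noteq> p (n - 1)"
        using chain_points_distinct[OF n(2)] n(3) by auto
    qed (use lift_k_subset_Rn assms in auto)
  qed
  then show ?thesis
    using mem_boundary_Rn_iff chain_points lift_k_subset_Rn assms by blast
qed

lemma segment_avoids_interiors:
  assumes n: "n < s" and l: "l \<in> Zn m"
  shows "closed_segment (p n) (p (n + 1)) \<inter> interior_Rn m (lift S l) = {}"
proof (rule ccontr)
  assume "\<not> ?thesis"
  then obtain q where q: "q \<in> closed_segment (p n) (p (n + 1))" "q \<in> interior_Rn m (lift S l)"
    by blast
  have ql: "q \<in> lift S l"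
    by (rule subsetD[OF interior_of_subset q(2)])
  consider "l = k n" | "l = k (n + 1)" | "l \<noteq> k n" "l \<noteq> k (n + 1)"
    by blast
  then show False
  proof cases
    case 1
    then have "q = p n"
      using segment_leaves_first_obstacle[OF n q(1)] ql by simp
    then show False
      using boundary_not_interior[OF chain_points_in_boundary[of n]] q(2) n 1 by auto
  next
    case 2
    then have "q = p (n + 1)"
      using segment_meets_last_obstacle_at_end[OF n q(1)] ql by simp
    then show False
      using boundary_not_interior[OF chain_points_in_boundary[of "n + 1"]] q(2) n 2 by auto
  next
    case 3
    have "q \<in> convex hull (lift S (k n) \<union> lift S (k (n + 1)))"
      using q(1) closed_segment_subset_hull_lift chain_points[of n] chain_points[of "n + 1"] n by fastforce
    then have "between S l (k n) (k (n + 1))"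
      using 3 ql by (auto simp: between_def)
    then show False
      using adm n l by (auto simp: admissible_def)
  qed
qed

lemma chain_reflects:
  assumes "0 < n" "n < s"
  shows "reflects m (lift S (k n)) (p (n - 1)) (p n) (p (n + 1))"
proof -
  have le: "n \<le> s" "0 < s"
    using assms by auto
  note Zn = k_in_Zn[OF le(1)]
  note pn = chain_points[OF le(1)] chain_points_in_boundary[OF le]
  have S: "S \<subseteq> Rn m" "smooth_boundary m S"
    using ob by (simp_all add: obstacle_def)
  have "p n - k n \<in> boundary_Rn m S"
    by (rule boundary_lift_imp_boundary[OF S(1) Zn pn])
  then obtain U f G where "local_defining_function m S (p n - k n) U f G"
    using S(2) unfolding smooth_boundary_def by blast
  from local_defining_function_translate[OF this Zn_subset_Rn[OF Zn]]
  have ldf: "local_defining_function m (lift S (k n)) (p n) ((\<lambda>x. x + k n) ` U) (\<lambda>x. f (x - k n)) G"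
    by (simp add: lift_def)
  show ?thesis
  proof (rule reflects_of_shortest[OF pn(2) ldf])
    have n: "n - 1 \<le> s" "n + 1 \<le> s" "n - 1 < s" "n - 1 + 1 = n"
      using assms by linarith+
    show "p (n - 1) \<in> Rn m" "p (n + 1) \<in> Rn m"
      using subsetD[OF lift_k_subset_Rn chain_points] n(1,2) by blast+
    show "p (n - 1) \<noteq> p n" "p (n + 1) \<noteq> p n"
      using chain_points_distinct[OF n(3)] chain_points_distinct[OF assms(2)] n(4) by simp_all
    show "p n \<notin> closed_segment (p (n - 1)) (p (n + 1))"
      by (rule chain_turns[OF assms])
    show "dist (p (n - 1)) (p n) + dist (p n) (p (n + 1)) \<le> dist (p (n - 1)) q + dist q (p (n + 1))"
      if "q \<in> lift S (k n)" for q
      by (rule shortest_chain_local(1)[OF p that assms])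
  qed (fact pn)
qed

text \<open>Minimality and the turn at each point keep a segment from passing through the two obstacles that
  it joins, the third condition of admissibility keeps it away from all others, and reflection points
  obey the first order condition of a minimum.\<close>

proposition shortest_chain_is_trajectory:
  assumes "0 < s"
  shows "trajectory_piece m S s k p"
  unfolding trajectory_piece_def
proof (intro conjI allI impI ballI)
  show "p n \<in> boundary_Rn m (lift S (k n))" if "n \<le> s" for n
    by (rule chain_points_in_boundary[OF that assms])
  show "p n \<noteq> p (n + 1)" if "n < s" for n
    by (rule chain_points_distinct[OF that])
  show "closed_segment (p n) (p (n + 1)) \<inter> interior_Rn m (lift S l) = {}"
    if "n < s" "l \<in> Zn m" for n l
    by (rule segment_avoids_interiors[OF that])
  show "reflects m (lift S (k n)) (p (n - 1)) (p n) (p (n + 1))" if "0 < n \<and> n < s" for n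
    using chain_reflects that by blast
qed

end

section \<open>Admissible pieces of prescribed displacement and length\<close>

lemma admissible_piece_of_shortest_chain:
  assumes "obstacle m S" "admissible m S s k" "shortest_chain S k s p" "0 < s"
  shows "admissible_piece m S (p 0) (p s) (path_length s p)"
  unfolding admissible_piece_def path_length_def
proof (intro exI conjI)
  show "admissible m S s k"
    by (fact assms(2))
  show "0 \<in> Zn m"
    by simp
  show "trajectory_piece m S s (\<lambda>n. 0 + k n) p"
    using shortest_chain_is_trajectory[OF assms] by simp
qed (rule refl)+

text \<open>Appending one step to the itinerary changes the minimal length by a bounded amount, since the last
  point can be moved to the next obstacle by the same lattice vector.  So the length of the piece can
  be tuned although it is not known explicitly.\<close>

lemma shortest_chain_extend:
  assumes p: "shortest_chain S k s p" and p': "shortest_chain S k (Suc s) p'"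
  shows "path_length (Suc s) p' \<le> path_length s p + norm (k (Suc s) - k s)"
proof -
  let ?q = "p(Suc s := p s + (k (Suc s) - k s))"
  have "chain S k (Suc s) ?q"
    using p by (auto simp: shortest_chain_def chain_def mem_lift_iff le_Suc_eq)
  then have "path_length (Suc s) p' \<le> path_length (Suc s) ?q"
    using p' by (simp add: shortest_chain_def)
  also have "\<dots> = path_length s ?q + norm (k (Suc s) - k s)"
    by (simp add: path_length_def dist_norm norm_minus_commute)
  also have "path_length s ?q = path_length s p"
    by (rule path_length_cong) simp
  finally show ?thesis .
qed

lemma shortest_chain_le:
  assumes "shortest_chain S k s p" "x \<in> S"
  shows "path_length s p \<le> (\<Sum>n<s. norm (k (Suc n) - k n))"
proof -
  have "chain S k s (\<lambda>n. x + k n)"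
    using assms(2) by (simp add: chain_def lift_def)
  then have "path_length s p \<le> path_length s (\<lambda>n. x + k n)"
    using assms(1) by (simp add: shortest_chain_def)
  then show ?thesis
    by (simp add: path_length_def dist_norm norm_minus_commute)
qed

lemma chain_points_near_lattice_points:
  assumes "bounded S" "chain S k s p" "i \<le> s" "j \<le> s"
  shows "norm (p j - p i - (k j - k i)) \<le> diameter S"
proof -
  have "p j - k j \<in> S" "p i - k i \<in> S"
    using assms by (auto simp: chain_def mem_lift_iff)
  from diameter_bounded_bound[OF assms(1) this] show ?thesis
    by (simp add: dist_norm algebra_simps)
qed

lemma chain_length_ge:
  assumes "bounded S" "chain S k s p"
  shows "(\<Sum>n<s. norm (k (Suc n) - k n) - diameter S) \<le> path_length s p"
  unfolding path_length_def
proof (rule sum_mono)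
  fix n assume "n \<in> {..<s}"
  then have "norm (p (Suc n) - p n - (k (Suc n) - k n)) \<le> diameter S"
    using chain_points_near_lattice_points[OF assms, of n "Suc n"] by simp
  moreover have "norm (k (Suc n) - k n) \<le> norm (p (Suc n) - p n) + norm (p (Suc n) - p n - (k (Suc n) - k n))"
    by (metis norm_minus_commute norm_triangle_sub)
  ultimately show "norm (k (Suc n) - k n) - diameter S \<le> dist (p n) (p (n + 1))"
    by (simp add: dist_norm norm_minus_commute)
qed

text \<open>After the steps in \<open>W\<close> the itinerary goes to and fro between two neighbouring obstacles, which wastes
  time without displacement, until the minimal length reaches \<open>\<tau>\<close>.\<close>

proposition admissible_piece_exists:
  assumes ob: "obstacle m S" and diam: "diameter S < \<delta>" and \<delta>: "2 * \<delta> \<le> 1" and m: "2 \<le> m"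
    and W: "\<forall>w\<in>set W. visible m (2 * \<delta>) w" "distinct_adj W" "W \<noteq> [] \<longrightarrow> last W \<noteq> axis_vec 0"
    and \<tau>: "0 < \<tau>" "(\<Sum>w\<leftarrow>W. norm w) \<le> \<tau>"
  shows "\<exists>x y t. admissible_piece m S x y t \<and> \<tau> \<le> t \<and> t \<le> \<tau> + 1 \<and> norm (y - x - sum_list W) \<le> 2"
proof -
  have S: "compact S" "convex S" "bounded S" "S \<noteq> {}"
    using ob compact_imp_bounded[of S] interior_of_subset[of "top_of_set (Rn m)" S]
    by (simp_all add: obstacle_def strictly_convex_def) blast
  define N where "N = length W"
  define w where "w n = (if n < N then W ! n else if even (n - N) then axis_vec 0 else - axis_vec 0)" for n
  define k where "k n = (\<Sum>i<n. w i)" for n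
  have k_Suc: "k (Suc n) - k n = w n" for n
    by (simp add: k_def)
  have vis: "visible m (2 * \<delta>) (w n)" for n
  proof -
    have "visible m (2 * \<delta>) (axis_vec 0)"
      by (rule visible_axis_vec) (use m \<delta> in auto)
    then show ?thesis
      using W(1) by (auto simp: w_def N_def visible_uminus)
  qed
  have ne: "w n \<noteq> w (n + 1)" for n
  proof -
    have "axis_vec 0 \<noteq> - axis_vec 0"
      by (metis axis_vec_nonzero add.right_inverse scaleR_2 scaleR_eq_0_iff zero_neq_numeral)
    consider "n + 1 < N" | "n + 1 = N" | "N \<le> n"
      by linarith
    then show ?thesis
    proof cases
      case 1
      then show ?thesis
        using distinct_adj_nth[OF W(2)] by (simp add: w_def N_def)
    next
      case 2
      then have "W \<noteq> []"
        by (auto simp: N_def)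
      moreover have "n = length W - 1"
        using 2 by (simp add: N_def)
      ultimately have "w n = last W"
        by (simp add: w_def N_def last_conv_nth)
      then show ?thesis
        using W(3) 2 \<open>W \<noteq> []\<close> by (simp add: w_def)
    next
      case 3
      then show ?thesis
        using \<open>axis_vec 0 \<noteq> - axis_vec 0\<close> by (auto simp: w_def Suc_diff_le)
    qed
  qed
  have adm: "admissible m S s k" for s
    unfolding k_def using admissible_of_visible_steps[OF S(2,3) diam] vis ne by blast
  have "\<forall>s. \<exists>p. shortest_chain S k s p"
    using shortest_chain_exists[OF S(1,4)] by blast
  then obtain P where P: "shortest_chain S k s (P s)" for s
    by metis
  define T where "T s = path_length s (P s)" for s
  have w1: "1 \<le> norm (w n)" for n
    using vis[of n] Zn_norm_ge_1[of "w n" m] unfolding visible_def by blast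
  \<comment> \<open>Every step takes time at least \<open>1 - \<delta> \<ge> 1 / 2\<close>, so that \<open>T\<close> does reach \<open>\<tau>\<close>.\<close>
  have T_ge: "s / 2 \<le> T s" for s
  proof -
    have "s / 2 = (\<Sum>n<s. 1 / 2)"
      by simp
    also have "\<dots> \<le> (\<Sum>n<s. norm (k (Suc n) - k n) - diameter S)"
    proof (rule sum_mono)
      show "1 / 2 \<le> norm (k (Suc n) - k n) - diameter S" for n
        unfolding k_Suc using w1[of n] diam \<delta> by linarith
    qed
    also have "\<dots> \<le> T s"
      unfolding T_def using chain_length_ge[OF S(3)] P by (simp add: shortest_chain_def)
    finally show ?thesis .
  qed
  have T_N: "T N \<le> \<tau>"
  proof -
    obtain x where x: "x \<in> S"
      using S(4) by blast
    have "T N \<le> (\<Sum>n<N. norm (w n))"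
      using shortest_chain_le[OF P[of N] x] by (simp only: T_def k_Suc)
    also have "\<dots> = (\<Sum>n<N. norm (W ! n))"
      by (intro sum.cong) (auto simp: w_def)
    also have "\<dots> = (\<Sum>w\<leftarrow>W. norm w)"
      by (simp add: sum_list_sum_nth N_def atLeast0LessThan)
    finally show ?thesis
      using \<tau> by linarith
  qed
  define s where "s = (LEAST s. N \<le> s \<and> \<tau> \<le> T s)"
  have ex: "\<exists>s. N \<le> s \<and> \<tau> \<le> T s"
  proof (intro exI conjI)
    show "N \<le> max N (nat \<lceil>2 * \<tau>\<rceil>)"
      by simp
    have "\<tau> \<le> real (max N (nat \<lceil>2 * \<tau>\<rceil>)) / 2"
      by linarith
    then show "\<tau> \<le> T (max N (nat \<lceil>2 * \<tau>\<rceil>))"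
      using T_ge order_trans by blast
  qed
  have s: "N \<le> s" "\<tau> \<le> T s"
    using LeastI_ex[OF ex] by (auto simp: s_def)
  have T_s: "T s \<le> \<tau> + 1"
  proof (cases "s = N")
    case True
    then show ?thesis
      using T_N by simp
  next
    case False
    then obtain r where r: "s = Suc r" "N \<le> r"
      using s(1) by (cases s) auto
    have "T r < \<tau>"
      using not_less_Least[of r "\<lambda>s. N \<le> s \<and> \<tau> \<le> T s"] r by (auto simp: s_def[symmetric])
    moreover have "T s \<le> T r + norm (w r)"
      using shortest_chain_extend[OF P[of r] P[of "Suc r"]] by (simp only: T_def r(1) k_Suc)
    moreover have "norm (w r) = 1"
      using r(2) by (simp add: w_def)
    ultimately show ?thesis
      by linarith
  qed
  have "0 < s"
    using s(2) \<tau>(1) by (cases s) (auto simp: T_def path_length_def)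
  then have piece: "admissible_piece m S (P s 0) (P s s) (T s)"
    unfolding T_def by (rule admissible_piece_of_shortest_chain[OF ob adm P])
  have "k N = sum_list W"
    unfolding k_def by (simp add: sum_list_sum_nth N_def atLeast0LessThan w_def)
  have k_after: "k (N + j) = sum_list W + (if even j then 0 else axis_vec 0)" for j
  proof (induction j)
    case (Suc j)
    then show ?case
      by (simp add: k_def w_def)
  qed (use \<open>k N = sum_list W\<close> in simp)
  have "k s = sum_list W \<or> k s = sum_list W + axis_vec 0"
    using k_after[of "s - N"] s(1) by auto
  then have "norm (k s - sum_list W) \<le> 1"
    by auto
  moreover have "norm (P s s - P s 0 - k s) \<le> diameter S"
    using chain_points_near_lattice_points[OF S(3), of k s "P s" 0 s] P[of s]
    by (simp add: shortest_chain_def k_def)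
  moreover have "norm (P s s - P s 0 - sum_list W)
      \<le> norm (P s s - P s 0 - k s) + norm (k s - sum_list W)"
    using dist_triangle[of "P s s - P s 0" "sum_list W" "k s"] by (simp only: dist_norm)
  ultimately have "norm (P s s - P s 0 - sum_list W) \<le> 2"
    using diam \<delta> by linarith
  then show ?thesis
    using piece s(2) T_s by blast
qed

section \<open>The admissible rotation set\<close>

lemma admissible_rotation_setI:
  assumes "v \<in> Rn m"
    and "\<And>\<eta>. 0 < \<eta> \<Longrightarrow> \<exists>x y t. admissible_piece m S x y t \<and> 1 / \<eta> \<le> t \<and> norm ((y - x) /\<^sub>R t - v) < \<eta>"
  shows "v \<in> admissible_rotation_set m S"
proof -
  have "\<forall>n. \<exists>x y t. admissible_piece m S x y t \<and> 1 / (1 / real (Suc n)) \<le> t \<and>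
      norm ((y - x) /\<^sub>R t - v) < 1 / real (Suc n)"
    by (intro allI assms(2)) simp
  then obtain x y t where *: "\<And>n. admissible_piece m S (x n) (y n) (t n)"
    "\<And>n. 1 / (1 / real (Suc n)) \<le> t n" "\<And>n. norm ((y n - x n) /\<^sub>R t n - v) < 1 / real (Suc n)"
    by metis
  have "real n \<le> t n" for n
    using *(2)[of n] by simp
  then have "filterlim t at_top sequentially"
    by (intro filterlim_at_top_mono[OF filterlim_real_sequentially]) simp
  moreover have "(\<lambda>n. (y n - x n) /\<^sub>R t n - v) \<longlonglongrightarrow> 0"
    by (rule LIMSEQ_norm_0) (fact *(3))
  then have "(\<lambda>n. (y n - x n) /\<^sub>R t n) \<longlonglongrightarrow> v"
    by (rule LIM_zero_cancel)
  ultimately show ?thesis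
    unfolding admissible_rotation_set_def using assms(1) *(1) by blast
qed

lemma admissible_rotation_setD:
  assumes "v \<in> admissible_rotation_set m S" "0 < \<eta>"
  shows "\<exists>x y t. admissible_piece m S x y t \<and> 1 / \<eta> \<le> t \<and> norm ((y - x) /\<^sub>R t - v) < \<eta>"
proof -
  obtain x y t where *: "\<And>n. admissible_piece m S (x n) (y n) (t n)"
    "filterlim t at_top sequentially" "(\<lambda>n. (y n - x n) /\<^sub>R t n) \<longlonglongrightarrow> v"
    using assms(1) unfolding admissible_rotation_set_def by blast
  have "\<forall>\<^sub>F n in sequentially. 1 / \<eta> \<le> t n"
    using *(2) by (simp add: filterlim_at_top)
  moreover have "\<forall>\<^sub>F n in sequentially. norm ((y n - x n) /\<^sub>R t n - v) < \<eta>"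
    using tendstoD[OF *(3) assms(2)] by (simp add: dist_norm)
  ultimately have "\<forall>\<^sub>F n in sequentially. 1 / \<eta> \<le> t n \<and> norm ((y n - x n) /\<^sub>R t n - v) < \<eta>"
    by (rule eventually_conj)
  then obtain n where "1 / \<eta> \<le> t n" "norm ((y n - x n) /\<^sub>R t n - v) < \<eta>"
    using eventually_happens by force
  then show ?thesis
    using *(1) by blast
qed

text \<open>The admissible rotation set is closed, so the supremum of the radii is attained.\<close>

lemma admissible_rotation_set_limit:
  assumes "v \<in> Rn m" "\<And>\<eta>. 0 < \<eta> \<Longrightarrow> \<exists>v'\<in>admissible_rotation_set m S. norm (v' - v) < \<eta>"
  shows "v \<in> admissible_rotation_set m S"
proof (rule admissible_rotation_setI[OF assms(1)])
  fix \<eta> :: real assume \<eta>: "0 < \<eta>"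
  obtain v' where v': "v' \<in> admissible_rotation_set m S" "norm (v' - v) < \<eta> / 2"
    using assms(2)[of "\<eta> / 2"] \<eta> by auto
  obtain x y t where xyt: "admissible_piece m S x y t" "1 / (\<eta> / 2) \<le> t" "norm ((y - x) /\<^sub>R t - v') < \<eta> / 2"
    using admissible_rotation_setD[OF v'(1), of "\<eta> / 2"] \<eta> by auto
  have "norm ((y - x) /\<^sub>R t - v) \<le> norm ((y - x) /\<^sub>R t - v') + norm (v' - v)"
    using dist_triangle[of "(y - x) /\<^sub>R t" v v'] by (simp only: dist_norm)
  then have "norm ((y - x) /\<^sub>R t - v) < \<eta>"
    using xyt(3) v'(2) by linarith
  moreover have "1 / \<eta> \<le> 1 / (\<eta> / 2)"
    using \<eta> by (simp add: field_simps)
  then have "1 / \<eta> \<le> t"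
    using xyt(2) by linarith
  ultimately show "\<exists>x y t. admissible_piece m S x y t \<and> 1 / \<eta> \<le> t \<and> norm ((y - x) /\<^sub>R t - v) < \<eta>"
    using xyt(1) by blast
qed

lemma norm_admissible_rotation_set_le_1:
  assumes "v \<in> admissible_rotation_set m S"
  shows "norm v \<le> 1"
proof (rule field_le_epsilon)
  fix \<eta> :: real assume \<eta>: "0 < \<eta>"
  then obtain x y t where *: "admissible_piece m S x y t" "1 / \<eta> \<le> t" "norm ((y - x) /\<^sub>R t - v) < \<eta>"
    using admissible_rotation_setD[OF assms] by blast
  have t: "0 < t"
    using \<eta> *(2) by (smt (verit) zero_less_divide_1_iff)
  have "norm (y - x) \<le> t"
    using *(1) dist_le_path_length unfolding admissible_piece_def path_length_def
    by (metis dist_norm dist_commute)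
  moreover have "norm ((y - x) /\<^sub>R t) = norm (y - x) / t"
    unfolding norm_scaleR using t by (simp add: divide_inverse mult.commute)
  ultimately have "norm ((y - x) /\<^sub>R t) \<le> 1"
    using t by simp
  moreover have "norm v \<le> norm ((y - x) /\<^sub>R t) + norm ((y - x) /\<^sub>R t - v)"
    by (metis norm_minus_commute norm_triangle_sub)
  ultimately show "norm v \<le> 1 + \<eta>"
    using *(3) by linarith
qed

lemma largest_ball_radius_exists:
  assumes m: "1 \<le> m" and r: "0 \<le> r" "cball 0 r \<inter> Rn m \<subseteq> admissible_rotation_set m S"
  shows "\<exists>\<rho>. largest_ball_radius m (admissible_rotation_set m S) \<rho> \<and> r \<le> \<rho> \<and> \<rho> \<le> 1"
proof -
  let ?A = "admissible_rotation_set m S"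
  define R where "R = {r. cball 0 r \<inter> Rn m \<subseteq> ?A}"
  have le_1: "r \<le> 1" if "r \<in> R" for r
  proof (cases "0 \<le> r")
    case True
    have "r *\<^sub>R axis_vec 0 \<in> cball 0 r \<inter> Rn m"
      using True m by (auto simp: Rn_def coord_axis_vec)
    then have "norm (r *\<^sub>R axis_vec 0) \<le> 1"
      using that norm_admissible_rotation_set_le_1 unfolding R_def by blast
    then show ?thesis
      by simp
  qed simp
  have bdd: "bdd_above R"
    using le_1 by (auto simp: bdd_above_def)
  have "r \<in> R"
    using r by (simp add: R_def)
  define \<rho> where "\<rho> = Sup R"
  have upper: "r' \<le> \<rho>" if "r' \<in> R" for r'
    unfolding \<rho>_def by (rule cSup_upper[OF that bdd])
  have "\<rho> \<le> 1"
    unfolding \<rho>_def by (rule cSup_least) (use \<open>r \<in> R\<close> le_1 in auto)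
  have "0 \<le> \<rho>"
    using upper[OF \<open>r \<in> R\<close>] r(1) by linarith
  have "v \<in> ?A" if v: "v \<in> Rn m" "norm v \<le> \<rho>" for v
  proof (rule admissible_rotation_set_limit[OF v(1)])
    fix \<eta> :: real assume \<eta>: "0 < \<eta>"
    \<comment> \<open>A slightly smaller multiple of \<open>v\<close> lies in a ball whose radius is below the supremum.\<close>
    define c where "c = (1 - min 1 (\<eta> / 2))"
    have c: "0 \<le> c" "c < 1" "1 - c \<le> \<eta> / 2"
      using \<eta> by (auto simp: c_def)
    have "c *\<^sub>R v \<in> ?A"
    proof (cases "norm v = 0")
      case True
      then have "c *\<^sub>R v \<in> cball 0 r \<inter> Rn m"
        using r(1) v(1) by auto
      then show ?thesis
        using r(2) by blast
    next
      case False
      then have "c * norm v < 1 * norm v"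
        using c by (intro mult_strict_right_mono) auto
      then have "c * norm v < \<rho>"
        using v(2) by linarith
      then obtain r' where r': "r' \<in> R" "c * norm v < r'"
        unfolding \<rho>_def using less_cSupE \<open>r \<in> R\<close> by (metis empty_iff)
      have "c *\<^sub>R v \<in> cball 0 r' \<inter> Rn m"
        using r'(2) c v(1) subspace_scale[OF subspace_Rn] by auto
      then show ?thesis
        using r'(1) unfolding R_def by blast
    qed
    moreover have "norm (c *\<^sub>R v - v) < \<eta>"
    proof -
      have "c *\<^sub>R v - v = (c - 1) *\<^sub>R v"
        by (simp add: algebra_simps)
      then have "norm (c *\<^sub>R v - v) = (1 - c) * norm v"
        using c by simp
      also have "\<dots> \<le> \<eta> / 2 * 1"
        by (rule mult_mono) (use c v \<open>\<rho> \<le> 1\<close> \<eta> in auto)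
      finally show ?thesis
        using \<eta> by simp
    qed
    ultimately show "\<exists>v'\<in>?A. norm (v' - v) < \<eta>"
      by blast
  qed
  then have "largest_ball_radius m ?A \<rho>"
    using \<open>0 \<le> \<rho>\<close> upper unfolding largest_ball_radius_def R_def by auto
  then show ?thesis
    using upper[OF \<open>r \<in> R\<close>] \<open>\<rho> \<le> 1\<close> by blast
qed

lemma lattice_rounding:
  assumes "x \<in> Rn m"
  shows "\<exists>K\<in>Zn m. norm (K - x) \<le> sqrt m"
proof -
  define K where "K = Abs_fseq (\<lambda>i. of_int \<lfloor>coord x i\<rfloor>)"
  have "finite {i. of_int \<lfloor>coord x i\<rfloor> \<noteq> (0::real)}"
    by (rule finite_subset[OF _ finite_supp[of x]]) auto
  then have K: "coord K i = of_int \<lfloor>coord x i\<rfloor>" for i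
    unfolding K_def by (subst coord_Abs) auto
  have "K \<in> Zn m"
    using assms by (auto simp: Zn_def Rn_def K)
  moreover have "norm (K - x) \<le> sqrt m"
  proof (rule norm_le_sqrt_of_coord_le_1)
    show "K - x \<in> Rn m"
      using assms Zn_subset_Rn[OF \<open>K \<in> Zn m\<close>] subspace_diff[OF subspace_Rn] by blast
    show "\<bar>coord (K - x) i\<bar> \<le> 1" for i
      unfolding coord_minus K by linarith
  qed
  ultimately show ?thesis
    by blast
qed

text \<open>To move with velocity \<open>v\<close>, round \<open>q *\<^sub>R v\<close> to a lattice vector \<open>K\<close> for a large number \<open>q\<close>, walk along
  \<open>fact L *\<^sub>R K\<close> by nearly straight steps and waste time until about \<open>fact L * q\<close>.  There is time to waste
  because the walk is longer than \<open>fact L * norm K\<close> at most by the factor \<open>1 + \<epsilon>\<close>, whereas \<open>norm v\<close> is at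
  most \<open>1 - \<epsilon>\<close>.  The rounding error grows with the dimension, but it is bounded as \<open>q\<close> tends to
  infinity.\<close>

proposition ball_subset_admissible_rotation_set:
  assumes ob: "obstacle m S" and m: "2 \<le> m" and diam: "diameter S < \<delta>"
    and \<epsilon>: "0 < \<epsilon>" and L: "3 \<le> L" and \<delta>: "0 < \<delta>" "8 * \<delta> \<le> 1" "4 * \<delta> * (fact L * L + 1) < 1"
    and factor: "1 + 2 / L \<le> (1 + \<epsilon>) * (1 - 4 * \<delta>)"
  shows "cball 0 (1 - \<epsilon>) \<inter> Rn m \<subseteq> admissible_rotation_set m S"
proof
  fix v assume "v \<in> cball 0 (1 - \<epsilon>) \<inter> Rn m"
  then have v: "norm v \<le> 1 - \<epsilon>" "v \<in> Rn m"
    by auto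
  define M :: real where "M = fact L"
  have M: "1 \<le> M"
    by (simp add: M_def)
  show "v \<in> admissible_rotation_set m S"
  proof (rule admissible_rotation_setI[OF v(2)])
    fix \<eta> :: real assume \<eta>: "0 < \<eta>"
    \<comment> \<open>\<open>C\<close> bounds the error in the displacement: 2 from the obstacles and the idle steps, 1 from the
      time, the rest from rounding.  The last bound on \<open>q\<close> makes the walk shorter than \<open>M * q\<close>.\<close>
    define C where "C = 3 + M * sqrt m"
    obtain q :: nat where q: "max (1 / \<eta>) (max (C / \<eta>) ((1 + \<epsilon>) * sqrt m / \<epsilon>\<^sup>2)) < q"
      using reals_Archimedean2 by blast
    have q0: "0 < real q"
      using q \<eta> by (smt (verit) zero_less_divide_1_iff)
    have q2: "(1 + \<epsilon>) * sqrt m < \<epsilon>\<^sup>2 * q" and q3: "C < \<eta> * q"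
      using q \<epsilon> \<eta> by (auto simp: field_simps)
    obtain K where K: "K \<in> Zn m" "norm (K - real q *\<^sub>R v) \<le> sqrt m"
      using lattice_rounding subspace_scale[OF subspace_Rn v(2)] by blast
    obtain W where W: "\<forall>w\<in>set W. visible m (2 * \<delta>) w" "distinct_adj W" "W \<noteq> [] \<longrightarrow> last W \<noteq> axis_vec 0"
      "sum_list W = M *\<^sub>R K"
      "(1 - 4 * \<delta>) * (\<Sum>w\<leftarrow>W. norm w) \<le> (1 + 2 / L) * (M * norm K)"
      using nearly_straight_steps[OF K(1) m L, of "2 * \<delta>"] \<delta> unfolding M_def by auto
    have "norm K \<le> q * (1 - \<epsilon>) + sqrt m"
    proof -
      have "norm K \<le> norm (real q *\<^sub>R v) + norm (K - real q *\<^sub>R v)"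
        by (rule norm_triangle_sub)
      also have "norm (real q *\<^sub>R v) \<le> q * (1 - \<epsilon>)"
        using v(1) by (simp add: mult_left_mono)
      finally show ?thesis
        using K(2) by linarith
    qed
    then have "(1 + \<epsilon>) * norm K \<le> (1 + \<epsilon>) * (q * (1 - \<epsilon>) + sqrt m)"
      using \<epsilon> by (intro mult_left_mono) auto
    also have "\<dots> = q - \<epsilon>\<^sup>2 * q + (1 + \<epsilon>) * sqrt m"
      by (simp add: algebra_simps power2_eq_square)
    also have "\<dots> \<le> q"
      using q2 by simp
    finally have K_le: "(1 + \<epsilon>) * norm K \<le> q" .
    have "(1 + 2 / L) * (M * norm K) \<le> ((1 + \<epsilon>) * (1 - 4 * \<delta>)) * (M * norm K)"
      by (rule mult_right_mono[OF factor]) (use M in simp)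
    then have "(1 - 4 * \<delta>) * (\<Sum>w\<leftarrow>W. norm w) \<le> ((1 + \<epsilon>) * (1 - 4 * \<delta>)) * (M * norm K)"
      using W(5) by linarith
    also have "\<dots> = (1 - 4 * \<delta>) * (M * ((1 + \<epsilon>) * norm K))"
      by simp
    also have "\<dots> \<le> (1 - 4 * \<delta>) * (M * q)"
      using K_le M \<delta> by (intro mult_left_mono) auto
    finally have W_le: "(\<Sum>w\<leftarrow>W. norm w) \<le> M * q"
      using \<delta> by simp
    have Mq: "q \<le> M * q"
      using M q0 by simp
    obtain x y t where xyt: "admissible_piece m S x y t" "M * q \<le> t" "t \<le> M * q + 1"
      "norm (y - x - M *\<^sub>R K) \<le> 2"
      using admissible_piece_exists[OF ob diam _ m W(1-3) _ W_le] \<delta> Mq q0 unfolding W(4) by force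
    have t: "q \<le> t"
      using xyt(2) Mq by linarith
    have "norm (y - x - t *\<^sub>R v) \<le> C"
    proof -
      have "y - x - t *\<^sub>R v = (y - x - M *\<^sub>R K) + M *\<^sub>R (K - real q *\<^sub>R v) + (M * q - t) *\<^sub>R v"
        by (simp add: algebra_simps)
      also have "norm \<dots> \<le> norm ((y - x - M *\<^sub>R K) + M *\<^sub>R (K - real q *\<^sub>R v)) + norm ((M * q - t) *\<^sub>R v)"
        by (rule norm_triangle_ineq)
      finally have "norm (y - x - t *\<^sub>R v)
          \<le> norm (y - x - M *\<^sub>R K) + norm (M *\<^sub>R (K - real q *\<^sub>R v)) + norm ((M * q - t) *\<^sub>R v)"
        using norm_triangle_ineq[of "y - x - M *\<^sub>R K" "M *\<^sub>R (K - real q *\<^sub>R v)"] by linarith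
      moreover have "norm (M *\<^sub>R (K - real q *\<^sub>R v)) \<le> M * sqrt m"
        using K(2) M by simp
      moreover have "norm ((M * q - t) *\<^sub>R v) \<le> 1 * 1"
        unfolding norm_scaleR by (rule mult_mono) (use xyt(2,3) v(1) \<epsilon> in auto)
      ultimately show ?thesis
        using xyt(4) unfolding C_def by linarith
    qed
    moreover have "(y - x) /\<^sub>R t - v = (y - x - t *\<^sub>R v) /\<^sub>R t"
      using t q0 by (simp add: algebra_simps)
    ultimately have "norm ((y - x) /\<^sub>R t - v) \<le> C / t"
      using t q0 by (simp add: divide_inverse mult.commute mult_left_mono)
    also have "\<eta> * q \<le> \<eta> * t"
      using t \<eta> by (intro mult_left_mono) auto
    then have "C / t < \<eta>"
      using q3 t q0 by (simp add: pos_divide_less_eq)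
    finally have "norm ((y - x) /\<^sub>R t - v) < \<eta>" .
    moreover have "1 / \<eta> \<le> t"
      using q t by simp
    ultimately show "\<exists>x y t. admissible_piece m S x y t \<and> 1 / \<eta> \<le> t \<and> norm ((y - x) /\<^sub>R t - v) < \<eta>"
      using xyt(1) by blast
  qed
qed

section \<open>The largest ball\<close>

theorem corollary4p14:
  shows "\<forall>\<epsilon>>0. \<exists>\<delta>>0. \<forall>m\<ge>2. \<forall>S. obstacle m S \<and> small S \<and> diameter S < \<delta> \<longrightarrow>
           (\<exists>\<rho>. largest_ball_radius m (admissible_rotation_set m S) \<rho> \<and> \<bar>\<rho> - 1\<bar> < \<epsilon>)"
proof (intro allI impI)
  fix \<epsilon> :: real assume "0 < \<epsilon>"
  define e where "e = min (\<epsilon> / 2) 1"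
  have e: "0 < e" "e \<le> 1" "e < \<epsilon>"
    using \<open>0 < \<epsilon>\<close> by (auto simp: e_def)
  \<comment> \<open>\<open>L\<close> makes the detours cheap; then \<open>\<delta>\<close> makes both the excess of the visible decomposition small
    and the perturbed multiples of vectors shorter than \<open>L\<close> visible.  Neither depends on \<open>m\<close>.\<close>
  define L where "L = nat \<lceil>8 / e\<rceil> + 3"
  have L: "3 \<le> L" "8 / e \<le> L"
    unfolding L_def by (simp, linarith)
  have L_e: "2 / L \<le> e / 4"
    using L e by (simp add: field_simps)
  define R :: real where "R = fact L * L + 1"
  have R: "1 \<le> R"
    by (simp add: R_def)
  define \<delta> where "\<delta> = e / (16 * R)"
  have \<delta>: "0 < \<delta>" "4 * \<delta> * R = e / 4"
    using e R by (auto simp: \<delta>_def)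
  have "4 * \<delta> * 1 \<le> 4 * \<delta> * R"
    by (rule mult_left_mono[OF R]) (use \<delta>(1) in simp)
  then have "4 * \<delta> \<le> e / 4"
    using \<delta>(2) by linarith
  have factor: "1 + 2 / L \<le> (1 + e) * (1 - 4 * \<delta>)"
  proof -
    have "e * e \<le> 1 * e"
      using e by (intro mult_right_mono) auto
    then have "1 + e / 4 \<le> 1 + 3 * e / 4 - e * e / 4"
      using e by linarith
    also have "\<dots> = (1 + e) * (1 - e / 4)"
      by (simp add: field_simps)
    also have "\<dots> \<le> (1 + e) * (1 - 4 * \<delta>)"
      using \<open>4 * \<delta> \<le> e / 4\<close> e by (intro mult_left_mono) auto
    finally show ?thesis
      using L_e by linarith
  qed
  show "\<exists>\<delta>>0. \<forall>m\<ge>2. \<forall>S. obstacle m S \<and> small S \<and> diameter S < \<delta> \<longrightarrow>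
           (\<exists>\<rho>. largest_ball_radius m (admissible_rotation_set m S) \<rho> \<and> \<bar>\<rho> - 1\<bar> < \<epsilon>)"
  proof (rule exI[of _ \<delta>], intro conjI allI impI \<delta>(1))
    fix m :: nat and S
    assume m: "2 \<le> m" and S: "obstacle m S \<and> small S \<and> diameter S < \<delta>"
    have "cball 0 (1 - e) \<inter> Rn m \<subseteq> admissible_rotation_set m S"
      by (rule ball_subset_admissible_rotation_set[OF _ m _ e(1) L(1) \<delta>(1) _ _ factor])
        (use S \<delta>(2) \<open>4 * \<delta> \<le> e / 4\<close> e in \<open>auto simp: R_def\<close>)
    then obtain \<rho> where "largest_ball_radius m (admissible_rotation_set m S) \<rho>" "1 - e \<le> \<rho>" "\<rho> \<le> 1"
      using largest_ball_radius_exists[of m "1 - e" S] m e by auto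
    then show "\<exists>\<rho>. largest_ball_radius m (admissible_rotation_set m S) \<rho> \<and> \<bar>\<rho> - 1\<bar> < \<epsilon>"
      using e by (intro exI[of _ \<rho>]) auto
  qed
qed

end
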